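(* $$\lim_{d\to+\infty}\ \inf\left\{p(t)\ :\ t=(t_1,t_2)\in\mathbb{R}^2,\ -\tfrac12\ln(d)+\ln(\ln(d))\le t_i\le0\ \text{ for } i=1,2\right\}=1.$$
   Context: For an integer $d\ge 1$, $H^0(\mathbb{CP}^2,L^d)$ is the space of homogeneous complex polynomials of degree $d$ in $X_0,X_1,X_2$, of dimension $N_d=(d+1)(d+2)/2$, with the Hermitian product for which distinct monomials are orthogonal and $\|X_0^{i_0}X_1^{i_1}X_2^{i_2}\|^2=\frac{2\,i_0!\,i_1!\,i_2!}{(d+2)!}$ when $i_0+i_1+i_2=d$, and with the Gaussian probability measure of density $\pi^{-N_d}e^{-\|P\|^2}$. $V_P=\{P=0\}\subset\mathbb{CP}^2$, $\mathbb{C}^2$ is identified with $\{X_0\neq0\}$ by $(z_1,z_2)\mapsto[1:z_1:z_2]$, and $\mathrm{Log}(z_1,z_2)=(\ln|z_1|,\ln|z_2|)$ on $(\mathbb{C}^\times)^2$. $p(t)$ (which depends on $d$) is the probability that $V_P\cap\mathrm{Log}^{-1}(t)\ne\emptyset$, i.e. that $t$ belongs to the amoeba $\mathcal{A}(P)=\mathrm{Log}(V_P\cap(\mathbb{C}^\times)^2)$. *)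

theory Defs
  imports "HOL-Probability.Probability"
begin

text \<open>
  A homogeneous polynomial of degree \<open>d\<close> in \<open>X\<^sub>0, X\<^sub>1, X\<^sub>2\<close> is represented by the family of its
  coefficients, an extensional function on the exponents \<open>(i\<^sub>0, i\<^sub>1, i\<^sub>2)\<close> of total degree \<open>d\<close>.
\<close>

type_synonym expo = "nat \<times> nat \<times> nat"

definition expos :: "nat \<Rightarrow> expo set" where
  "expos d = {(i0, i1, i2). i0 + i1 + i2 = d}"

definition hpolys :: "nat \<Rightarrow> (expo \<Rightarrow> complex) set" where
  "hpolys d = (\<Pi>\<^sub>E \<alpha>\<in>expos d. UNIV)"

definition hpoly_eval :: "nat \<Rightarrow> (expo \<Rightarrow> complex) \<Rightarrow> complex \<times> complex \<times> complex \<Rightarrow> complex" where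
  "hpoly_eval d P = (\<lambda>(x0, x1, x2). \<Sum>(i0, i1, i2)\<in>expos d. P (i0, i1, i2) * x0 ^ i0 * x1 ^ i1 * x2 ^ i2)"

definition monom_norm_sq :: "nat \<Rightarrow> expo \<Rightarrow> real" where
  "monom_norm_sq d = (\<lambda>(i0, i1, i2). 2 * fact i0 * fact i1 * fact i2 / fact (d + 2))"

definition herm :: "nat \<Rightarrow> (expo \<Rightarrow> complex) \<Rightarrow> (expo \<Rightarrow> complex) \<Rightarrow> complex" where
  "herm d P Q = (\<Sum>\<alpha>\<in>expos d. complex_of_real (monom_norm_sq d \<alpha>) * P \<alpha> * cnj (Q \<alpha>))"

definition hnorm :: "nat \<Rightarrow> (expo \<Rightarrow> complex) \<Rightarrow> real" where
  "hnorm d P = sqrt (Re (herm d P P))"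

definition dimN :: "nat \<Rightarrow> nat" where
  "dimN d = (d + 1) * (d + 2) div 2"

text \<open>
  The Lebesgue measure on the Hermitian space of polynomials is normalised by the Hermitian
  product: it is the standard Lebesgue measure in the coordinates with respect to the orthonormal
  basis of normalised monomials, not in the coefficients with respect to the monomials themselves.
\<close>

definition hpoly_lebesgue :: "nat \<Rightarrow> (expo \<Rightarrow> complex) measure" where
  "hpoly_lebesgue d =
     distr (\<Pi>\<^sub>M \<alpha>\<in>expos d. lborel) (\<Pi>\<^sub>M \<alpha>\<in>expos d. borel)
       (\<lambda>c. \<lambda>\<alpha>\<in>expos d. c \<alpha> / complex_of_real (sqrt (monom_norm_sq d \<alpha>)))"

lemma measurable_normalise:
  "(\<lambda>c. \<lambda>\<alpha>\<in>expos d. c \<alpha> / complex_of_real (sqrt (monom_norm_sq d \<alpha>)))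
     \<in> measurable (\<Pi>\<^sub>M \<alpha>\<in>expos d. lborel) (\<Pi>\<^sub>M \<alpha>\<in>expos d. borel)"
  by measurable

definition hpoly_gauss :: "nat \<Rightarrow> (expo \<Rightarrow> complex) measure" where
  "hpoly_gauss d =
     density (hpoly_lebesgue d) (\<lambda>P. ennreal (exp (- (hnorm d P)\<^sup>2) / pi ^ dimN d))"

text \<open>Points of \<open>\<complex>P\<^sup>2\<close> are the \<open>\<complex>\<^sup>\<times>\<close>-orbits of nonzero vectors of \<open>\<complex>\<^sup>3\<close>.\<close>

definition proj_pt :: "complex \<times> complex \<times> complex \<Rightarrow> (complex \<times> complex \<times> complex) set" where
  "proj_pt = (\<lambda>(x0, x1, x2). {(c * x0, c * x1, c * x2) | c. c \<noteq> 0})"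

definition CP2 :: "(complex \<times> complex \<times> complex) set set" where
  "CP2 = proj_pt ` (UNIV - {0})"

definition vanishing_locus :: "nat \<Rightarrow> (expo \<Rightarrow> complex) \<Rightarrow> (complex \<times> complex \<times> complex) set set" where
  "vanishing_locus d P = {x \<in> CP2. \<forall>v\<in>x. hpoly_eval d P v = 0}"

definition affine_chart :: "complex \<times> complex \<Rightarrow> (complex \<times> complex \<times> complex) set" where
  "affine_chart = (\<lambda>(z1, z2). proj_pt (1, z1, z2))"

definition torus :: "(complex \<times> complex) set" where
  "torus = {(z1, z2). z1 \<noteq> 0 \<and> z2 \<noteq> 0}"

definition Log :: "complex \<times> complex \<Rightarrow> real \<times> real" where
  "Log = (\<lambda>(z1, z2). (ln (norm z1), ln (norm z2)))"

definition amoeba :: "nat \<Rightarrow> (expo \<Rightarrow> complex) \<Rightarrow> (real \<times> real) set" where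
  "amoeba d P = Log ` {z \<in> torus. affine_chart z \<in> vanishing_locus d P}"

definition amoeba_prob :: "nat \<Rightarrow> real \<times> real \<Rightarrow> real" where
  "amoeba_prob d t = measure (hpoly_gauss d) {P \<in> hpolys d. t \<in> amoeba d P}"

lemma mem_amoeba_iff:
  "t \<in> amoeba d P \<longleftrightarrow> vanishing_locus d P \<inter> affine_chart ` {z \<in> torus. Log z = t} \<noteq> {}"
  unfolding amoeba_def by auto

lemma space_hpoly_gauss: "space (hpoly_gauss d) = hpolys d"
  by (simp add: hpoly_gauss_def hpoly_lebesgue_def hpolys_def space_PiM)

lemma hpoly_eval_scale:
  "hpoly_eval d P (c * x0, c * x1, c * x2) = c ^ d * hpoly_eval d P (x0, x1, x2)"
proof -
  have "(\<Sum>(i0, i1, i2)\<in>expos d. P (i0, i1, i2) * (c * x0) ^ i0 * (c * x1) ^ i1 * (c * x2) ^ i2)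
      = (\<Sum>(i0, i1, i2)\<in>expos d. c ^ d * (P (i0, i1, i2) * x0 ^ i0 * x1 ^ i1 * x2 ^ i2))"
    by (rule sum.cong) (auto simp: expos_def power_mult_distrib power_add)
  then show ?thesis
    by (simp add: hpoly_eval_def sum_distrib_left case_prod_unfold)
qed

lemma card_expos: "card (expos d) = dimN d"
proof -
  have eq: "expos d = (\<lambda>(j, i). (i, j - i, d - j)) ` (SIGMA j:{..d}. {..j})"
  proof (intro subset_antisym subsetI)
    fix x assume "x \<in> expos d"
    then obtain a b c where "x = (a, b, c)" "a + b + c = d" by (auto simp: expos_def)
    then show "x \<in> (\<lambda>(j, i). (i, j - i, d - j)) ` (SIGMA j:{..d}. {..j})"
      by (intro image_eqI[of _ _ "(a + b, a)"]) auto
  qed (auto simp: expos_def)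
  have "inj_on (\<lambda>(j, i). (i, j - i, d - j)) (SIGMA j:{..d}. {..j})"
    by (auto simp: inj_on_def)
  then have "card (expos d) = (\<Sum>j\<le>d. Suc j)"
    by (simp add: eq card_image)
  also have "\<dots> = dimN d"
    by (induction d) (auto simp: dimN_def algebra_simps)
  finally show ?thesis .
qed

end

theory Submission
  imports Defs "HOL-Real_Asymp.Real_Asymp"
begin

text \<open>
  Put \<open>r\<^sub>i = exp t\<^sub>i\<close>. In orthonormal coordinates \<open>c\<close>, the restriction of the polynomial to the torus
  \<open>Log\<^sup>-\<^sup>1(t)\<close> is, up to a constant, \<open>f\<^sub>c(\<theta>) = \<Sum>\<alpha>. c\<^sub>\<alpha> \<surd>p\<^sub>\<alpha> exp(i(\<alpha>\<^sub>1\<theta>\<^sub>1 + \<alpha>\<^sub>2\<theta>\<^sub>2))\<close>, where \<open>p\<close> is the trinomial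
  distribution with weights proportional to \<open>(1, r\<^sub>1\<^sup>2, r\<^sub>2\<^sup>2)\<close>. Around \<open>M\<close> equidistant points of a circle
  in the torus take patches \<open>\<bar>\<theta>\<^sub>i\<bar> \<le> 1 / (8 r\<^sub>i \<surd>d)\<close>. On each of them \<open>f\<^sub>c\<close> is bounded with high
  probability, by moment bounds on its Taylor coefficients, and there is a vector \<open>v\<^sub>k\<close> of bounded norm
  such that \<open>f\<close> of \<open>v\<^sub>k\<close> is a nonvanishing function times an almost \<open>\<real>\<close>-linear isomorphism. For a large
  constant \<open>s\<close>, Brouwer's theorem then yields a zero of \<open>f\<close> at \<open>c + s v\<^sub>k\<close> on the \<open>k\<close>-th patch.
  Since \<open>r\<^sub>i \<surd>d \<ge> ln d\<close>, the vectors \<open>v\<^sub>k\<close> are asymptotically orthogonal, so the average over \<open>k\<close> of the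
  Gaussian measures translated by \<open>s v\<^sub>k\<close> has a density that is \<open>L\<^sup>2\<close>-close to \<open>1\<close> when \<open>M\<close> and
  then \<open>d\<close> are large. Hence \<open>f\<^sub>c\<close> itself has a zero with probability close to \<open>1\<close>.
\<close>

subsection \<open>Complex Gaussian vectors and their translates\<close>

text \<open>The standard complex Gaussian measure, with E|c_i|^2 = 1 for each coordinate. For
  \<open>I = expos d\<close> it is the law of the coordinates of the random polynomial in the
  orthonormal basis of normalised monomials.\<close>

definition cgauss :: "'i set \<Rightarrow> ('i \<Rightarrow> complex) measure" where
  "cgauss I = density (\<Pi>\<^sub>M i\<in>I. lborel)
     (\<lambda>c. ennreal (exp (- (\<Sum>i\<in>I. (norm (c i))\<^sup>2)) / pi ^ card I))"

lemma product_sigma_finite_lborel: "product_sigma_finite (\<lambda>_::'i. lborel :: 'a::euclidean_space measure)"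
  by (simp add: product_sigma_finite_def lborel.sigma_finite_measure_axioms)

lemma space_cgauss [simp]: "space (cgauss I) = (\<Pi>\<^sub>E i\<in>I. UNIV)"
  by (simp add: cgauss_def space_PiM)

lemma sets_cgauss [measurable_cong]: "sets (cgauss I) = sets (\<Pi>\<^sub>M i\<in>I. lborel)"
  by (simp add: cgauss_def)

lemma nn_integral_gauss_real: "(\<integral>\<^sup>+x. ennreal (exp (- x\<^sup>2)) \<partial>lborel) = ennreal (sqrt pi)"
proof -
  \<comment> \<open>Variance 1/2 turns the normal density into exp(-x^2) / sqrt pi.\<close>
  let ?d = "normal_density 0 (1 / sqrt 2)"
  have d: "exp (- x\<^sup>2) = sqrt pi * ?d x" for x
    by (simp add: normal_density_def power_divide)
  have "(\<integral>\<^sup>+x. ennreal (exp (- x\<^sup>2)) \<partial>lborel) = (\<integral>\<^sup>+x. ennreal (sqrt pi) * ennreal (?d x) \<partial>lborel)"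
    unfolding d by (simp add: ennreal_mult)
  also have "\<dots> = ennreal (sqrt pi) * (\<integral>\<^sup>+x. ennreal (?d x) \<partial>lborel)"
    by (rule nn_integral_cmult) simp
  also have "(\<integral>\<^sup>+x. ennreal (?d x) \<partial>lborel) = 1"
    by (subst nn_integral_eq_integral) (auto intro: integrable_normal_density integral_normal_density)
  finally show ?thesis by simp
qed

lemma nn_integral_gauss_complex:
  "(\<integral>\<^sup>+z. ennreal (exp (- (norm (z::complex))\<^sup>2)) \<partial>lborel) = ennreal pi"
proof -
  have "exp (- (norm z)\<^sup>2) = (\<Prod>b\<in>Basis. exp (- (z \<bullet> b)\<^sup>2))" for z :: complex
    by (simp add: Basis_complex_def cmod_power2 exp_add [symmetric])
  then have "(\<integral>\<^sup>+z. ennreal (exp (- (norm (z::complex))\<^sup>2)) \<partial>lborel)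
      = (\<integral>\<^sup>+z. (\<Prod>b\<in>Basis. ennreal (exp (- ((z::complex) \<bullet> b)\<^sup>2))) \<partial>lborel)"
    by (simp add: prod_ennreal)
  also have "\<dots> = (\<Prod>b\<in>(Basis::complex set). \<integral>\<^sup>+x. ennreal (exp (- x\<^sup>2)) \<partial>lborel)"
    by (rule nn_integral_lborel_prod) auto
  also have "\<dots> = ennreal pi"
    by (simp add: nn_integral_gauss_real Basis_complex_def flip: ennreal_mult)
  finally show ?thesis .
qed

lemma prob_space_cgauss:
  assumes "finite I"
  shows "prob_space (cgauss I)"
proof
  interpret product_sigma_finite "\<lambda>_::'a. lborel :: complex measure"
    by (rule product_sigma_finite_lborel)
  have "emeasure (cgauss I) (space (cgauss I))
      = (\<integral>\<^sup>+c. ennreal (exp (- (\<Sum>i\<in>I. (norm (c i :: complex))\<^sup>2)) / pi ^ card I) \<partial>(\<Pi>\<^sub>M i\<in>I. lborel))"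
    unfolding cgauss_def by (subst emeasure_density) (auto intro!: nn_integral_cong)
  also have "\<dots> = (\<integral>\<^sup>+c. (\<Prod>i\<in>I. ennreal (exp (- (norm (c i :: complex))\<^sup>2) / pi)) \<partial>(\<Pi>\<^sub>M i\<in>I. lborel))"
    by (simp add: prod_ennreal prod_dividef exp_sum[OF assms] flip: sum_negf)
  also have "\<dots> = (\<Prod>i\<in>I. \<integral>\<^sup>+z. ennreal (exp (- (norm (z::complex))\<^sup>2) / pi) \<partial>lborel)"
    by (rule product_nn_integral_prod[OF assms]) auto
  also have "(\<integral>\<^sup>+z. ennreal (exp (- (norm (z::complex))\<^sup>2) / pi) \<partial>lborel) = 1"
    by (simp add: divide_ennreal[symmetric] nn_integral_divide nn_integral_gauss_complex)
  finally show "emeasure (cgauss I) (space (cgauss I)) = 1"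
    by simp
qed

lemma distr_PiM_lborel_translate:
  fixes w :: "'i \<Rightarrow> 'a::euclidean_space"
  assumes "finite I"
  shows "distr (\<Pi>\<^sub>M i\<in>I. lborel) (\<Pi>\<^sub>M i\<in>I. lborel) (\<lambda>c. \<lambda>i\<in>I. w i + c i) = (\<Pi>\<^sub>M i\<in>I. lborel)"
proof -
  interpret product_sigma_finite "\<lambda>_::'i. lborel :: 'a measure"
    by (rule product_sigma_finite_lborel)
  show ?thesis
  proof (rule PiM_eqI)
    fix A :: "'i \<Rightarrow> 'a set"
    assume A: "\<And>i. i \<in> I \<Longrightarrow> A i \<in> sets lborel"
    have m: "(\<lambda>c. \<lambda>i\<in>I. w i + c i) \<in> measurable (\<Pi>\<^sub>M i\<in>I. lborel) (\<Pi>\<^sub>M i\<in>I. lborel)"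
      by measurable
    have vim: "(\<lambda>c. \<lambda>i\<in>I. w i + c i) -` (Pi\<^sub>E I A) \<inter> space (\<Pi>\<^sub>M i\<in>I. lborel)
        = (\<Pi>\<^sub>E i\<in>I. (+) (w i) -` A i)"
      by (auto simp: space_PiM PiE_iff extensional_def)
    have "emeasure (distr (\<Pi>\<^sub>M i\<in>I. lborel) (\<Pi>\<^sub>M i\<in>I. lborel) (\<lambda>c. \<lambda>i\<in>I. w i + c i)) (Pi\<^sub>E I A)
        = emeasure (\<Pi>\<^sub>M i\<in>I. lborel) (\<Pi>\<^sub>E i\<in>I. (+) (w i) -` A i)"
      by (subst emeasure_distr[OF m]) (use A assms in \<open>auto simp: vim\<close>)
    also have "\<dots> = (\<Prod>i\<in>I. emeasure lborel ((+) (w i) -` A i))"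
    proof (rule emeasure_PiM[OF assms])
      fix i assume "i \<in> I"
      have "(+) (w i) \<in> measurable lborel lborel" by simp
      from measurable_sets[OF this A[OF \<open>i \<in> I\<close>]]
      show "(+) (w i) -` A i \<in> sets lborel" by simp
    qed
    also have "\<dots> = (\<Prod>i\<in>I. emeasure lborel (A i))"
    proof (rule prod.cong[OF refl])
      fix i assume "i \<in> I"
      have "emeasure lborel (A i) = emeasure (distr lborel borel ((+) (w i))) (A i)"
        by (simp add: lborel_distr_plus)
      also have "\<dots> = emeasure lborel ((+) (w i) -` A i)"
        by (subst emeasure_distr) (use A[OF \<open>i \<in> I\<close>] in auto)
      finally show "emeasure lborel ((+) (w i) -` A i) = emeasure lborel (A i)" ..
    qed
    finally show "emeasure (distr (\<Pi>\<^sub>M i\<in>I. lborel) (\<Pi>\<^sub>M i\<in>I. lborel) (\<lambda>c. \<lambda>i\<in>I. w i + c i)) (Pi\<^sub>E I A)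
        = (\<Prod>i\<in>I. emeasure lborel (A i))" .
  qed (use assms in auto)
qed

text \<open>Completing the square, |c|^2 = |w + c|^2 + |w|^2 - 2 Re <w + c, w>, and using the
  translation invariance of Lebesgue measure moves the translation from the argument of \<phi> into
  a density.\<close>

lemma nn_integral_cgauss_Cameron_Martin:
  assumes I: "finite I" and [measurable]: "\<phi> \<in> borel_measurable (\<Pi>\<^sub>M i\<in>I. lborel)"
  shows "(\<integral>\<^sup>+c. \<phi> (\<lambda>i\<in>I. w i + c i) \<partial>cgauss I)
    = (\<integral>\<^sup>+c. ennreal (exp (2 * Re (\<Sum>i\<in>I. c i * cnj (w i)) - (\<Sum>i\<in>I. (norm (w i))\<^sup>2))) * \<phi> c \<partial>cgauss I)"
proof -
  let ?L = "\<Pi>\<^sub>M i\<in>I. (lborel :: complex measure)"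
  let ?g = "\<lambda>c. exp (- (\<Sum>i\<in>I. (norm (c i :: complex))\<^sup>2)) / pi ^ card I"
  let ?r = "\<lambda>c. exp (2 * Re (\<Sum>i\<in>I. c i * cnj (w i)) - (\<Sum>i\<in>I. (norm (w i))\<^sup>2))"
  let ?T = "\<lambda>c. \<lambda>i\<in>I. w i + c i"
  have T [measurable]: "?T \<in> measurable ?L ?L"
    by measurable
  have g: "?g c = ?r (?T c) * ?g (?T c)" for c
  proof -
    have n: "(norm z)\<^sup>2 = (norm (w i + z))\<^sup>2 + (norm (w i))\<^sup>2 - 2 * Re ((w i + z) * cnj (w i))" for i z
      by (simp only: cmod_power2) (simp add: power2_eq_square algebra_simps)
    have "(\<Sum>i\<in>I. (norm (c i))\<^sup>2) = (\<Sum>i\<in>I. (norm (?T c i))\<^sup>2 + (norm (w i))\<^sup>2 - 2 * Re (?T c i * cnj (w i)))"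
      by (rule sum.cong[OF refl], subst n) simp
    then show ?thesis
      by (simp add: sum.distrib sum_subtractf sum_distrib_left exp_add [symmetric] flip: sum_distrib_left)
  qed
  have "(\<integral>\<^sup>+c. \<phi> (?T c) \<partial>cgauss I) = (\<integral>\<^sup>+c. ennreal (?g c) * \<phi> (?T c) \<partial>?L)"
    unfolding cgauss_def by (subst nn_integral_density) auto
  also have "\<dots> = (\<integral>\<^sup>+c. (\<lambda>c. ennreal (?r c * ?g c) * \<phi> c) (?T c) \<partial>?L)"
    by (subst g) simp
  also have "\<dots> = (\<integral>\<^sup>+c. ennreal (?r c * ?g c) * \<phi> c \<partial>distr ?L ?L ?T)"
    by (subst nn_integral_distr) auto
  also have "\<dots> = (\<integral>\<^sup>+c. ennreal (?r c * ?g c) * \<phi> c \<partial>?L)"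
    by (simp add: distr_PiM_lborel_translate[OF I])
  also have "\<dots> = (\<integral>\<^sup>+c. ennreal (?g c) * (ennreal (?r c) * \<phi> c) \<partial>?L)"
    by (rule nn_integral_cong) (simp only: ennreal_mult'' exp_ge_zero mult_ac)
  also have "\<dots> = (\<integral>\<^sup>+c. ennreal (?r c) * \<phi> c \<partial>cgauss I)"
    unfolding cgauss_def by (subst nn_integral_density) auto
  finally show ?thesis .
qed

text \<open>The Cameron--Martin density has total mass 1: the case \<phi> = 1 of the formula yields
  the Laplace transform of the Gaussian.\<close>

lemma has_bochner_integral_cgauss_exp:
  assumes "finite I"
  shows "has_bochner_integral (cgauss I) (\<lambda>c. exp (2 * Re (\<Sum>i\<in>I. c i * cnj (w i))))
    (exp (\<Sum>i\<in>I. (norm (w i))\<^sup>2))"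
proof (rule has_bochner_integral_nn_integral)
  interpret prob_space "cgauss I" by (rule prob_space_cgauss[OF assms])
  let ?n = "\<Sum>i\<in>I. (norm (w i))\<^sup>2"
  let ?e = "\<lambda>c. exp (2 * Re (\<Sum>i\<in>I. c i * cnj (w i)))"
  have "1 = (\<integral>\<^sup>+c. ennreal (exp (2 * Re (\<Sum>i\<in>I. c i * cnj (w i)) - ?n)) * 1 \<partial>cgauss I)"
    by (subst nn_integral_cgauss_Cameron_Martin[OF assms, of "\<lambda>_. 1", symmetric]) (auto simp: emeasure_space_1[simplified])
  also have "\<dots> = (\<integral>\<^sup>+c. ennreal (?e c) / ennreal (exp ?n) \<partial>cgauss I)"
    by (simp add: exp_diff divide_ennreal)
  also have "\<dots> = (\<integral>\<^sup>+c. ennreal (?e c) \<partial>cgauss I) / ennreal (exp ?n)"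
    by (rule nn_integral_divide) measurable
  finally have *: "1 = (\<integral>\<^sup>+c. ennreal (?e c) \<partial>cgauss I) / ennreal (exp ?n)" .
  have "X = ennreal (exp ?n) * (X / ennreal (exp ?n))" for X
    by (subst ennreal_times_divide) (simp add: ennreal_mult_divide_eq mult.commute)
  from this[of "\<integral>\<^sup>+c. ennreal (?e c) \<partial>cgauss I"] show "(\<integral>\<^sup>+c. ennreal (?e c) \<partial>cgauss I) = ennreal (exp ?n)"
    by (metis * mult.right_neutral)
qed auto

text \<open>A Chebyshev bound drawn from the Laplace transform: |Z|^2 is at most A/2 times the sum
  of four exponentials of Z / sqrt A, each of expectation at most e, and Markov's inequality
  finishes.\<close>

lemma prob_cgauss_linear_ge:
  assumes I: "finite I" and A: "(\<Sum>i\<in>I. (norm (a i))\<^sup>2) \<le> A" "A > 0" and T: "T > 0"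
  shows "measure (cgauss I) {c \<in> space (cgauss I). (norm (\<Sum>i\<in>I. a i * c i))\<^sup>2 \<ge> T} \<le> 2 * exp 1 * A / T"
proof -
  interpret prob_space "cgauss I" by (rule prob_space_cgauss[OF I])
  let ?Z = "\<lambda>c. \<Sum>i\<in>I. a i * c i"
  define u where "u = (\<lambda>i. a i / complex_of_real (sqrt A))"
  define E where "E = (\<lambda>(\<zeta>::complex) (c::'a \<Rightarrow> complex). exp (2 * Re (\<Sum>i\<in>I. c i * cnj (cnj (\<zeta> * u i)))))"
  have E: "has_bochner_integral (cgauss I) (E \<zeta>) (exp (\<Sum>i\<in>I. (norm (cnj (\<zeta> * u i)))\<^sup>2))" for \<zeta>
    unfolding E_def by (rule has_bochner_integral_cgauss_exp[OF I])
  have sm: "(\<Sum>i\<in>I. (norm (cnj (\<zeta> * u i)))\<^sup>2) \<le> 1" if "norm \<zeta> = 1" for \<zeta>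
  proof -
    have "(\<Sum>i\<in>I. (norm (cnj (\<zeta> * u i)))\<^sup>2) = (\<Sum>i\<in>I. (norm (a i))\<^sup>2) / A"
      using that A by (simp add: u_def norm_mult norm_divide power_divide sum_divide_distrib)
    then show ?thesis using A by simp
  qed
  have EZ: "E \<zeta> c = exp (2 * Re (\<zeta> * ?Z c) / sqrt A)" for \<zeta> c
  proof -
    have "(\<Sum>i\<in>I. c i * cnj (cnj (\<zeta> * u i))) = (\<zeta> * ?Z c) / complex_of_real (sqrt A)"
      by (simp add: u_def sum_divide_distrib sum_distrib_left mult_ac)
    then show ?thesis
      by (simp only: E_def Re_divide_of_real) simp
  qed
  \<comment> \<open>For \<zeta> = 1, -1, -\<i>, \<i> these are the exponentials of plus and minus 2
    Re Z / sqrt A and of plus and minus 2 Im Z / sqrt A.\<close>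
  define h where "h = (\<lambda>c. (E 1 c + E (-1) c + (E (-\<i>) c + E \<i> c)) / 2 * A)"
  have h_int: "integrable (cgauss I) h" and h_le: "(\<integral>c. h c \<partial>cgauss I) \<le> 2 * exp 1 * A"
  proof -
    have hb: "has_bochner_integral (cgauss I) h
       ((exp (\<Sum>i\<in>I. (norm (cnj (1 * u i)))\<^sup>2) + exp (\<Sum>i\<in>I. (norm (cnj (-1 * u i)))\<^sup>2)
        + (exp (\<Sum>i\<in>I. (norm (cnj (-\<i> * u i)))\<^sup>2) + exp (\<Sum>i\<in>I. (norm (cnj (\<i> * u i)))\<^sup>2))) / 2 * A)"
      unfolding h_def by (intro has_bochner_integral_mult_left has_bochner_integral_divide has_bochner_integral_add E)
    then show "integrable (cgauss I) h" by (rule integrable.intros)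
    have "(exp (\<Sum>i\<in>I. (norm (cnj (1 * u i)))\<^sup>2) + exp (\<Sum>i\<in>I. (norm (cnj (-1 * u i)))\<^sup>2)
        + (exp (\<Sum>i\<in>I. (norm (cnj (-\<i> * u i)))\<^sup>2) + exp (\<Sum>i\<in>I. (norm (cnj (\<i> * u i)))\<^sup>2))) / 2 * A
       \<le> (exp 1 + exp 1 + (exp 1 + exp 1)) / 2 * A"
      using A by (intro mult_right_mono divide_right_mono add_mono exp_le_cancel_iff[THEN iffD2] sm) auto
    then show "(\<integral>c. h c \<partial>cgauss I) \<le> 2 * exp 1 * A"
      by (simp add: has_bochner_integral_integral_eq[OF hb])
  qed
  have h_ge: "(norm (?Z c))\<^sup>2 \<le> h c" for c
  proof -
    have sq: "t\<^sup>2 \<le> 2 * (exp t + exp (- t))" for t :: real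
    proof -
      have "t\<^sup>2 \<le> 2 * exp \<bar>t\<bar>"
        using exp_lower_Taylor_quadratic[of "\<bar>t\<bar>"] by simp
      also have "exp \<bar>t\<bar> \<le> exp t + exp (- t)"
        by (cases "t \<ge> 0") auto
      finally show ?thesis by simp
    qed
    let ?x = "2 * Re (?Z c) / sqrt A" and ?y = "2 * Im (?Z c) / sqrt A"
    have "(norm (?Z c))\<^sup>2 = (?x\<^sup>2 + ?y\<^sup>2) / 4 * A"
      using A by (simp add: cmod_power2 power_divide field_simps)
    also have "\<dots> \<le> (2 * (exp ?x + exp (- ?x)) + 2 * (exp ?y + exp (- ?y))) / 4 * A"
      using A by (intro mult_right_mono divide_right_mono add_mono sq) auto
    also have "\<dots> = h c"
      by (simp add: h_def EZ algebra_simps)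
    finally show ?thesis .
  qed
  have h_nn: "0 \<le> h c" for c
    using h_ge[of c] by (rule order_trans[rotated]) simp
  have [measurable]: "h \<in> borel_measurable (cgauss I)" using h_int by measurable
  have "measure (cgauss I) {c \<in> space (cgauss I). (norm (?Z c))\<^sup>2 \<ge> T}
      \<le> measure (cgauss I) {c \<in> space (cgauss I). h c \<ge> T}"
  proof (rule finite_measure_mono)
    show "{c \<in> space (cgauss I). h c \<ge> T} \<in> sets (cgauss I)" by measurable
  qed (auto intro: order_trans[OF _ h_ge])
  also have "\<dots> \<le> (\<integral>c. h c \<partial>cgauss I) / T"
    by (rule integral_Markov_inequality_measure[OF h_int sets.empty_sets]) (use h_nn T in auto)
  also have "\<dots> \<le> 2 * exp 1 * A / T"
    using h_le T by (simp add: divide_right_mono)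
  finally show ?thesis .
qed

text \<open>By the Cameron--Martin formula, the square of the \<open>L\<^sup>2\<close>-distance to \<open>1\<close> of the density of the average
  translate is the left-hand side of \<open>chi\<close> divided by \<open>M\<^sup>2\<close>.\<close>

lemma prob_cgauss_ge_average:
  fixes w :: "nat \<Rightarrow> 'i \<Rightarrow> complex"
  assumes I: "finite I" and Z: "Z \<in> sets (cgauss I)" and M: "M > 0" and \<epsilon>: "\<epsilon> > 0"
    and chi: "(\<Sum>k<M. \<Sum>l<M. exp (2 * Re (\<Sum>i\<in>I. w k i * cnj (w l i))) - 1) \<le> (\<epsilon> * real M)\<^sup>2"
    and p: "\<And>k. k < M \<Longrightarrow> p \<le> measure (cgauss I) {c \<in> space (cgauss I). (\<lambda>i\<in>I. w k i + c i) \<in> Z}"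
  shows "p - \<epsilon> \<le> measure (cgauss I) Z"
proof -
  interpret prob_space "cgauss I" by (rule prob_space_cgauss[OF I])
  note Z [measurable]
  let ?n = "\<lambda>k. \<Sum>i\<in>I. (norm (w k i))\<^sup>2"
  let ?ip = "\<lambda>k l. Re (\<Sum>i\<in>I. w k i * cnj (w l i))"
  \<comment> \<open>\<open>r k\<close> is the density of the law of \<open>w k + c\<close> with
    respect to the Gaussian, and \<rho> that of the average of these laws.\<close>
  define r where "r = (\<lambda>k (c::'i \<Rightarrow> complex). exp (2 * Re (\<Sum>i\<in>I. c i * cnj (w k i)) - ?n k))"
  define \<rho> where "\<rho> = (\<lambda>c. (\<Sum>k<M. r k c) / real M)"
  have r1: "has_bochner_integral (cgauss I) (r k) 1" for k
  proof -
    have "has_bochner_integral (cgauss I) (\<lambda>c. exp (2 * Re (\<Sum>i\<in>I. c i * cnj (w k i))) / exp (?n k))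
        (exp (?n k) / exp (?n k))"
      by (intro has_bochner_integral_divide has_bochner_integral_cgauss_exp[OF I])
    then show ?thesis by (simp add: r_def exp_diff)
  qed
  \<comment> \<open>The Laplace transform at \<open>w k + w l\<close> and polarisation: the second
    moment of \<rho> depends only on the inner products of the translations.\<close>
  have r2: "has_bochner_integral (cgauss I) (\<lambda>c. r k c * r l c) (exp (2 * ?ip k l))" for k l
  proof -
    have "has_bochner_integral (cgauss I)
        (\<lambda>c. exp (2 * Re (\<Sum>i\<in>I. c i * cnj (w k i + w l i))) / exp (?n k + ?n l))
        (exp (\<Sum>i\<in>I. (norm (w k i + w l i))\<^sup>2) / exp (?n k + ?n l))"
      by (intro has_bochner_integral_divide has_bochner_integral_cgauss_exp[OF I])
    moreover have "exp (2 * Re (\<Sum>i\<in>I. c i * cnj (w k i + w l i))) / exp (?n k + ?n l) = r k c * r l c" for c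
      by (simp add: r_def exp_diff [symmetric] exp_add [symmetric] sum.distrib algebra_simps)
    moreover have "exp (\<Sum>i\<in>I. (norm (w k i + w l i))\<^sup>2) / exp (?n k + ?n l) = exp (2 * ?ip k l)"
    proof -
      have "(norm (x + y))\<^sup>2 = (norm x)\<^sup>2 + (norm y)\<^sup>2 + 2 * Re (x * cnj y)" for x y :: complex
        by (simp only: cmod_power2) (simp add: power2_eq_square algebra_simps)
      then show ?thesis
        by (simp add: exp_diff [symmetric] sum.distrib sum_distrib_left flip: sum_distrib_left)
    qed
    ultimately show ?thesis by simp
  qed
  have \<rho>1: "has_bochner_integral (cgauss I) \<rho> 1"
  proof -
    have "has_bochner_integral (cgauss I) \<rho> ((\<Sum>k<M. 1) / real M)"
      unfolding \<rho>_def by (intro has_bochner_integral_divide has_bochner_integral_sum r1)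
    then show ?thesis using M by simp
  qed
  have \<rho>2: "has_bochner_integral (cgauss I) (\<lambda>c. (\<rho> c)\<^sup>2) ((\<Sum>k<M. \<Sum>l<M. exp (2 * ?ip k l)) / (real M)\<^sup>2)"
  proof -
    have "has_bochner_integral (cgauss I) (\<lambda>c. (\<Sum>k<M. \<Sum>l<M. r k c * r l c) / (real M)\<^sup>2)
        ((\<Sum>k<M. \<Sum>l<M. exp (2 * ?ip k l)) / (real M)\<^sup>2)"
      by (intro has_bochner_integral_divide has_bochner_integral_sum r2)
    then show ?thesis by (simp add: \<rho>_def power2_eq_square sum_product)
  qed
  have const: "has_bochner_integral (cgauss I) (\<lambda>_. a) a" for a :: real
    using has_bochner_integral_integrable[of "cgauss I" "\<lambda>_. a"] prob_space by simp
  have dev: "has_bochner_integral (cgauss I) (\<lambda>c. (\<rho> c - 1)\<^sup>2)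
      ((\<Sum>k<M. \<Sum>l<M. exp (2 * ?ip k l)) / (real M)\<^sup>2 - 2 * 1 + 1)"
  proof -
    have "has_bochner_integral (cgauss I) (\<lambda>c. (\<rho> c)\<^sup>2 - 2 * \<rho> c + 1)
        ((\<Sum>k<M. \<Sum>l<M. exp (2 * ?ip k l)) / (real M)\<^sup>2 - 2 * 1 + 1)"
      by (intro has_bochner_integral_add has_bochner_integral_diff has_bochner_integral_mult_right \<rho>1 \<rho>2 const)
    then show ?thesis by (simp add: power2_diff algebra_simps)
  qed
  have dev_le: "(\<integral>c. (\<rho> c - 1)\<^sup>2 \<partial>cgauss I) \<le> \<epsilon>\<^sup>2"
  proof -
    have "(\<integral>c. (\<rho> c - 1)\<^sup>2 \<partial>cgauss I) = ((\<Sum>k<M. \<Sum>l<M. exp (2 * ?ip k l)) - (real M)\<^sup>2) / (real M)\<^sup>2"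
      using has_bochner_integral_integral_eq[OF dev] M by (simp add: field_simps)
    also have "\<dots> = (\<Sum>k<M. \<Sum>l<M. exp (2 * ?ip k l) - 1) / (real M)\<^sup>2"
      by (simp add: sum_subtractf power2_eq_square)
    also have "\<dots> \<le> (\<epsilon> * real M)\<^sup>2 / (real M)\<^sup>2"
      by (intro divide_right_mono chi) auto
    also have "\<dots> = \<epsilon>\<^sup>2" using M by (simp add: power_mult_distrib)
    finally show ?thesis .
  qed
  have [measurable]: "r k \<in> borel_measurable (cgauss I)" "\<rho> \<in> borel_measurable (cgauss I)" for k
    using r1[of k] \<rho>1 by (auto dest: has_bochner_integral_iff[THEN iffD1])
  \<comment> \<open>The Cameron--Martin formula read backwards, for the indicator of
    \<open>Z\<close>.\<close>
  have tr: "has_bochner_integral (cgauss I) (\<lambda>c. r k c * indicator Z c)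
      (measure (cgauss I) {c \<in> space (cgauss I). (\<lambda>i\<in>I. w k i + c i) \<in> Z})" for k
  proof (rule has_bochner_integral_nn_integral)
    let ?S = "{c \<in> space (cgauss I). (\<lambda>i\<in>I. w k i + c i) \<in> Z}"
    have [measurable]: "?S \<in> sets (cgauss I)"
    proof -
      have "(\<lambda>c. \<lambda>i\<in>I. w k i + c i) \<in> measurable (cgauss I) (cgauss I)"
        by (simp add: measurable_cong_sets[OF sets_cgauss sets_cgauss])
      from measurable_sets[OF this Z] show ?thesis
        by (simp add: vimage_def Int_def conj_commute)
    qed
    have "(\<integral>\<^sup>+c. ennreal (r k c * indicator Z c) \<partial>cgauss I)
        = (\<integral>\<^sup>+c. ennreal (r k c) * indicator Z c \<partial>cgauss I)"
      by (rule nn_integral_cong) (auto simp: indicator_def)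
    also have "\<dots> = (\<integral>\<^sup>+c. indicator Z (\<lambda>i\<in>I. w k i + c i) \<partial>cgauss I)"
      unfolding r_def by (subst nn_integral_cgauss_Cameron_Martin[OF I, of "indicator Z"])
        (use Z in \<open>auto simp: sets_cgauss\<close>)
    also have "\<dots> = (\<integral>\<^sup>+c. indicator ?S c \<partial>cgauss I)"
      by (rule nn_integral_cong) (auto simp: indicator_def)
    also have "\<dots> = emeasure (cgauss I) ?S"
      by (rule nn_integral_indicator) measurable
    also have "\<dots> = ennreal (measure (cgauss I) ?S)"
      by (rule emeasure_eq_measure)
    finally show "(\<integral>\<^sup>+c. ennreal (r k c * indicator Z c) \<partial>cgauss I) = ennreal (measure (cgauss I) ?S)" .
  qed (auto simp: r_def)
  let ?P = "\<lambda>k. measure (cgauss I) {c \<in> space (cgauss I). (\<lambda>i\<in>I. w k i + c i) \<in> Z}"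
  have avg: "has_bochner_integral (cgauss I) (\<lambda>c. \<rho> c * indicator Z c) ((\<Sum>k<M. ?P k) / real M)"
  proof -
    have "has_bochner_integral (cgauss I) (\<lambda>c. (\<Sum>k<M. r k c * indicator Z c) / real M) ((\<Sum>k<M. ?P k) / real M)"
      by (intro has_bochner_integral_divide has_bochner_integral_sum tr)
    then show ?thesis by (simp add: \<rho>_def sum_distrib_right)
  qed
  have rhs: "has_bochner_integral (cgauss I) (\<lambda>c. indicator Z c + ((\<rho> c - 1)\<^sup>2 / (2 * \<epsilon>) + \<epsilon> / 2))
      (measure (cgauss I) Z + ((\<integral>c. (\<rho> c - 1)\<^sup>2 \<partial>cgauss I) / (2 * \<epsilon>) + \<epsilon> / 2))"
  proof (intro has_bochner_integral_add has_bochner_integral_divide const)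
    show "has_bochner_integral (cgauss I) (indicator Z) (measure (cgauss I) Z)"
      using Z by (intro has_bochner_integral_real_indicator) (auto simp: emeasure_eq_measure)
    show "has_bochner_integral (cgauss I) (\<lambda>c. (\<rho> c - 1)\<^sup>2) (\<integral>c. (\<rho> c - 1)\<^sup>2 \<partial>cgauss I)"
      using dev by (simp only: has_bochner_integral_integral_eq[OF dev])
  qed
  have "p * real M \<le> (\<Sum>k<M. ?P k)"
    using sum_mono[of "{..<M}" "\<lambda>_. p" ?P] p by (simp add: mult.commute)
  then have "p \<le> (\<Sum>k<M. ?P k) / real M"
    using M by (simp add: field_simps)
  also have "\<dots> = (\<integral>c. \<rho> c * indicator Z c \<partial>cgauss I)"
    using has_bochner_integral_integral_eq[OF avg] ..
  also have "\<dots> \<le> (\<integral>c. indicator Z c + ((\<rho> c - 1)\<^sup>2 / (2 * \<epsilon>) + \<epsilon> / 2) \<partial>cgauss I)"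
  proof (rule integral_mono)
    show "integrable (cgauss I) (\<lambda>c. \<rho> c * indicator Z c)"
      using avg by (rule integrable.intros)
    show "integrable (cgauss I) (\<lambda>c. indicator Z c + ((\<rho> c - 1)\<^sup>2 / (2 * \<epsilon>) + \<epsilon> / 2))"
      using rhs by (rule integrable.intros)
    fix c
    \<comment> \<open>The arithmetic-geometric mean inequality in the role of Cauchy--Schwarz: after
      integration each of the two terms is at most \<epsilon> / 2.\<close>
    have "x \<le> x\<^sup>2 / (2 * \<epsilon>) + \<epsilon> / 2" for x :: real
      using sum_squares_bound[of x \<epsilon>] \<epsilon> by (simp add: field_simps power2_eq_square)
    from this[of "\<rho> c - 1"] this[of 0]
    show "\<rho> c * indicator Z c \<le> indicator Z c + ((\<rho> c - 1)\<^sup>2 / (2 * \<epsilon>) + \<epsilon> / 2)"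
      using \<epsilon> by (auto simp: indicator_def)
  qed
  also have "\<dots> = measure (cgauss I) Z + ((\<integral>c. (\<rho> c - 1)\<^sup>2 \<partial>cgauss I) / (2 * \<epsilon>) + \<epsilon> / 2)"
    using has_bochner_integral_integral_eq[OF rhs] .
  also have "\<dots> \<le> measure (cgauss I) Z + (\<epsilon>\<^sup>2 / (2 * \<epsilon>) + \<epsilon> / 2)"
    using \<epsilon> by (intro add_left_mono add_right_mono divide_right_mono dev_le) auto
  also have "\<dots> = measure (cgauss I) Z + \<epsilon>"
    using \<epsilon> by (simp add: power2_eq_square)
  finally show ?thesis by simp
qed

subsection \<open>Trinomial sums\<close>

definition tri :: "expo \<Rightarrow> real" where
  "tri = (\<lambda>(i0, i1, i2). fact (i0 + i1 + i2) / (fact i0 * fact i1 * fact i2))"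

definition mon :: "'a::comm_monoid_mult \<Rightarrow> 'a \<Rightarrow> 'a \<Rightarrow> expo \<Rightarrow> 'a" where
  "mon y0 y1 y2 = (\<lambda>(i0, i1, i2). y0 ^ i0 * y1 ^ i1 * y2 ^ i2)"

definition lin :: "'a::semiring_1 \<Rightarrow> 'a \<Rightarrow> 'a \<Rightarrow> expo \<Rightarrow> 'a" where
  "lin l0 l1 l2 = (\<lambda>(i0, i1, i2). l0 * of_nat i0 + l1 * of_nat i1 + l2 * of_nat i2)"

lemma expos_eq_image: "expos d = (\<lambda>(i, j). (i, j, d - i - j)) ` (SIGMA i:{..d}. {..d - i})"
proof (intro subset_antisym subsetI)
  fix x assume "x \<in> expos d"
  then obtain a b c where "x = (a, b, c)" "a + b + c = d" by (auto simp: expos_def)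
  then show "x \<in> (\<lambda>(i, j). (i, j, d - i - j)) ` (SIGMA i:{..d}. {..d - i})"
    by (intro image_eqI[of _ _ "(a, b)"]) auto
qed (auto simp: expos_def)

lemma finite_expos [simp]: "finite (expos d)"
  by (simp add: expos_eq_image)

lemma tri_pos: "tri \<alpha> > 0"
  by (cases \<alpha>) (simp add: tri_def)

text \<open>The binomial theorem twice: first \<open>y0\<close> is split from
  \<open>y1 + y2\<close>, then \<open>y1\<close> from \<open>y2\<close>.\<close>

lemma trinomial_theorem:
  fixes y0 y1 y2 :: "'a :: real_field"
  shows "(\<Sum>\<alpha>\<in>expos d. of_real (tri \<alpha>) * mon y0 y1 y2 \<alpha>) = (y0 + y1 + y2) ^ d"
proof -
  have "inj_on (\<lambda>(i, j). (i, j, d - i - j)) (SIGMA i:{..d}. {..d - i})"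
    by (auto simp: inj_on_def)
  then have "(\<Sum>\<alpha>\<in>expos d. of_real (tri \<alpha>) * mon y0 y1 y2 \<alpha>)
      = (\<Sum>(i, j)\<in>(SIGMA i:{..d}. {..d - i}). of_real (tri (i, j, d - i - j)) * mon y0 y1 y2 (i, j, d - i - j))"
    by (simp add: expos_eq_image sum.reindex case_prod_unfold)
  also have "\<dots> = (\<Sum>i\<le>d. \<Sum>j\<le>d - i. of_real (tri (i, j, d - i - j)) * mon y0 y1 y2 (i, j, d - i - j))"
    by (rule sum.Sigma [symmetric]) auto
  also have "\<dots> = (\<Sum>i\<le>d. of_nat (d choose i) * y0 ^ i * (y1 + y2) ^ (d - i))"
  proof (rule sum.cong[OF refl])
    fix i assume i: "i \<in> {..d}"
    have "of_real (tri (i, j, d - i - j)) * mon y0 y1 y2 (i, j, d - i - j)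
       = of_nat (d choose i) * y0 ^ i * (of_nat ((d - i) choose j) * y1 ^ j * y2 ^ (d - i - j))"
      if "j \<le> d - i" for j
    proof -
      have "tri (i, j, d - i - j) = real (d choose i) * real ((d - i) choose j)"
        using i that by (simp add: tri_def binomial_fact)
      then show ?thesis by (simp add: mon_def)
    qed
    then show "(\<Sum>j\<le>d - i. of_real (tri (i, j, d - i - j)) * mon y0 y1 y2 (i, j, d - i - j))
        = of_nat (d choose i) * y0 ^ i * (y1 + y2) ^ (d - i)"
      by (simp add: binomial_ring[of y1 y2] sum_distrib_left)
  qed
  also have "\<dots> = (y0 + (y1 + y2)) ^ d"
    by (rule binomial_ring [symmetric])
  finally show ?thesis by (simp add: add.assoc)
qed

text \<open>Exponential tilting of the weights: moments of linear functions of the exponent become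
  derivatives in \<open>s\<close> of a closed formula.\<close>

lemma mon_exp_lin:
  "mon (y0 * exp (s * l0)) (y1 * exp (s * l1)) (y2 * exp (s * l2)) \<alpha>
     = mon y0 y1 y2 \<alpha> * exp (s * lin l0 l1 l2 \<alpha>)" for s :: complex
  by (cases \<alpha>) (simp add: mon_def lin_def power_mult_distrib exp_add distrib_left mult_ac exp_of_nat2_mult
      flip: exp_of_nat_mult)

lemma trinomial_exp_lin:
  fixes y0 y1 y2 :: complex
  shows "(\<Sum>\<alpha>\<in>expos d. of_real (tri \<alpha>) * mon y0 y1 y2 \<alpha> * exp (s * lin l0 l1 l2 \<alpha>))
    = (y0 * exp (s * l0) + y1 * exp (s * l1) + y2 * exp (s * l2)) ^ d"
  by (simp add: trinomial_theorem [symmetric] mon_exp_lin mult.assoc)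

text \<open>Both sides are the derivative of \<open>trinomial_exp_lin\<close> at s = 0. The
  truncated \<open>d - 1\<close> is harmless, since the factor d vanishes for d = 0.\<close>

lemma trinomial_lin:
  fixes y0 y1 y2 :: complex
  shows "(\<Sum>\<alpha>\<in>expos d. of_real (tri \<alpha>) * mon y0 y1 y2 \<alpha> * lin l0 l1 l2 \<alpha>)
    = of_nat d * (y0 + y1 + y2) ^ (d - 1) * (y0 * l0 + y1 * l1 + y2 * l2)"
proof -
  let ?F = "\<lambda>s. \<Sum>\<alpha>\<in>expos d. of_real (tri \<alpha>) * mon y0 y1 y2 \<alpha> * exp (s * lin l0 l1 l2 \<alpha>)"
  have "(?F has_field_derivative (\<Sum>\<alpha>\<in>expos d. of_real (tri \<alpha>) * mon y0 y1 y2 \<alpha> * lin l0 l1 l2 \<alpha>)) (at 0)"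
    by (auto intro!: derivative_eq_intros sum.cong simp: mult_ac)
  moreover have "(?F has_field_derivative of_nat d * (y0 + y1 + y2) ^ (d - 1) * (y0 * l0 + y1 * l1 + y2 * l2)) (at 0)"
    unfolding trinomial_exp_lin by (auto intro!: derivative_eq_intros)
  ultimately show ?thesis by (rule DERIV_unique)
qed

text \<open>\<open>trinomial_lin\<close> holds for the tilted weights too and is differentiated once
  more. The truncated \<open>d - 2\<close> occurs only next to d (d - 1), which vanishes for d \<le>
  1.\<close>

lemma trinomial_lin_lin:
  fixes y0 y1 y2 :: complex
  shows "(\<Sum>\<alpha>\<in>expos d. of_real (tri \<alpha>) * mon y0 y1 y2 \<alpha> * (lin l0 l1 l2 \<alpha> * lin m0 m1 m2 \<alpha>))
    = of_nat d * of_nat (d - 1) * (y0 + y1 + y2) ^ (d - 2) * (y0 * l0 + y1 * l1 + y2 * l2) * (y0 * m0 + y1 * m1 + y2 * m2)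
      + of_nat d * (y0 + y1 + y2) ^ (d - 1) * (y0 * l0 * m0 + y1 * l1 * m1 + y2 * l2 * m2)"
proof -
  let ?F = "\<lambda>s. \<Sum>\<alpha>\<in>expos d. of_real (tri \<alpha>) * mon y0 y1 y2 \<alpha> * exp (s * lin l0 l1 l2 \<alpha>) * lin m0 m1 m2 \<alpha>"
  have F: "?F s = of_nat d * (y0 * exp (s * l0) + y1 * exp (s * l1) + y2 * exp (s * l2)) ^ (d - 1)
      * (y0 * exp (s * l0) * m0 + y1 * exp (s * l1) * m1 + y2 * exp (s * l2) * m2)" for s
    using trinomial_lin[where d = d, of "y0 * exp (s * l0)" "y1 * exp (s * l1)" "y2 * exp (s * l2)" m0 m1 m2]
    unfolding mon_exp_lin by (simp add: mult_ac)
  have "(?F has_field_derivative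
      (\<Sum>\<alpha>\<in>expos d. of_real (tri \<alpha>) * mon y0 y1 y2 \<alpha> * (lin l0 l1 l2 \<alpha> * lin m0 m1 m2 \<alpha>))) (at 0)"
    by (auto intro!: derivative_eq_intros sum.cong)
  moreover have "(?F has_field_derivative
      of_nat d * of_nat (d - 1) * (y0 + y1 + y2) ^ (d - 2) * (y0 * l0 + y1 * l1 + y2 * l2) * (y0 * m0 + y1 * m1 + y2 * m2)
      + of_nat d * (y0 + y1 + y2) ^ (d - 1) * (y0 * l0 * m0 + y1 * l1 * m1 + y2 * l2 * m2)) (at 0)"
    unfolding F by (auto intro!: derivative_eq_intros simp: algebra_simps numeral_2_eq_2)
  ultimately show ?thesis by (rule DERIV_unique)
qed

subsection \<open>The random function on a torus\<close>

text \<open>Expand \<open>cis\<close> in its Taylor series; the moments of \<open>c\<close> are the coefficients.\<close>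

lemma norm_sum_cis_le:
  fixes c :: "'i \<Rightarrow> complex" and x :: "'i \<Rightarrow> real"
  assumes K: "\<And>m. norm (\<Sum>i\<in>I. c i * of_real (x i ^ m)) \<le> K * R ^ m * fact m"
    and R: "R \<ge> 0" and \<theta>: "\<bar>\<theta>\<bar> * R \<le> 1 / 2"
  shows "norm (\<Sum>i\<in>I. c i * cis (x i * \<theta>)) \<le> 2 * K"
proof -
  let ?t = "\<lambda>m. \<Sum>i\<in>I. c i * ((\<i> * of_real (x i * \<theta>)) ^ m /\<^sub>R fact m)"
  have K0: "K \<ge> 0"
    using order_trans[OF norm_ge_zero K[of 0]] by simp
  have "?t sums (\<Sum>i\<in>I. c i * exp (\<i> * of_real (x i * \<theta>)))"
    by (intro sums_sum sums_mult exp_converges)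
  then have sums: "?t sums (\<Sum>i\<in>I. c i * cis (x i * \<theta>))"
    by (simp only: cis_conv_exp)
  have bound: "norm (?t m) \<le> K * (1 / 2) ^ m" for m
  proof -
    have "?t m = (\<i> * of_real \<theta>) ^ m / fact m * (\<Sum>i\<in>I. c i * of_real (x i ^ m))"
      by (simp add: sum_distrib_left scaleR_conv_of_real power_mult_distrib field_simps)
    then have "norm (?t m) = \<bar>\<theta>\<bar> ^ m / fact m * norm (\<Sum>i\<in>I. c i * of_real (x i ^ m))"
      by (simp add: norm_mult norm_divide norm_power)
    also have "\<dots> \<le> \<bar>\<theta>\<bar> ^ m / fact m * (K * R ^ m * fact m)"
      by (intro mult_left_mono K) auto
    also have "\<dots> = K * (\<bar>\<theta>\<bar> * R) ^ m"
      by (simp add: power_mult_distrib)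
    also have "\<dots> \<le> K * (1 / 2) ^ m"
      using R by (intro mult_left_mono power_mono \<theta> K0) auto
    finally show ?thesis .
  qed
  have "norm (suminf ?t) \<le> (\<Sum>m. K * (1 / 2) ^ m)"
    by (rule norm_suminf_le[OF bound]) (auto intro!: summable_mult summable_geometric)
  also have "\<dots> = 2 * K"
    by (simp add: suminf_mult suminf_geometric)
  finally show ?thesis
    using sums by (simp add: sums_iff)
qed

text \<open>Replaces the (2m)! in an even moment by the square of m! that a Taylor coefficient
  allows, at the cost of 4^m.\<close>

lemma fact_double_le: "fact (2 * m) \<le> ((2 ^ m * fact m)\<^sup>2 :: real)"
proof (induction m)
  case (Suc m)
  have "fact (2 * Suc m) = (2 * real m + 2) * (2 * real m + 1) * fact (2 * m)"
    by (simp add: algebra_simps)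
  also have "\<dots> \<le> (2 * real m + 2) * (2 * real m + 2) * (2 ^ m * fact m)\<^sup>2"
    by (intro mult_mono Suc.IH) auto
  also have "\<dots> = (2 ^ Suc m * fact (Suc m))\<^sup>2"
    by (simp add: power2_eq_square algebra_simps)
  finally show ?case .
qed simp

lemma power_le_fact_exp: "\<bar>x\<bar> ^ n \<le> fact n * exp \<bar>x\<bar>" for x :: real
proof -
  have "(\<Sum>k\<in>{n}. \<bar>x\<bar> ^ k /\<^sub>R fact k) \<le> exp \<bar>x\<bar>"
    unfolding exp_def by (rule sum_le_suminf) (use summable_exp_generic[of "\<bar>x\<bar>"] in auto)
  then show ?thesis by (simp add: field_simps)
qed

lemma exp_le_quadratic: "\<bar>x\<bar> \<le> 1 \<Longrightarrow> exp x \<le> 1 + x + x\<^sup>2" for x :: real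
proof (cases "x \<ge> 0")
  case False
  assume x: "\<bar>x\<bar> \<le> 1"
  define y where "y = - x"
  have y: "0 \<le> y" "y \<le> 1" using x False by (auto simp: y_def)
  \<comment> \<open>The product equals 1 + y^3.\<close>
  have "1 \<le> (1 - y + y\<^sup>2) * (1 + y)"
    using y by (simp add: algebra_simps power2_eq_square)
  also have "\<dots> \<le> (1 - y + y\<^sup>2) * exp y"
    using y by (intro mult_left_mono exp_ge_add_one_self) (auto simp: add_nonneg_nonneg)
  finally show ?thesis
    by (simp add: y_def exp_minus field_simps)
qed (use exp_bound in auto)

section \<open>Moments of the trinomial distribution\<close>

locale torus_fibre =
  fixes d :: nat and r1 r2 :: real
  assumes r1: "0 < r1" "r1 \<le> 1" and r2: "0 < r2" "r2 \<le> 1"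
    and lam_ge_1: "1 \<le> sqrt (real d) * r1" "1 \<le> sqrt (real d) * r2"
begin

text \<open>Up to bounded factors the standard deviation of the exponent of X_1 under
  \<open>p\<close>: the variance is d q1 (1 - q1), where d q1 = lam1^2 / D, 1 \<le> D \<le> 3 and q1
  \<le> 1/2. Hence angles vary naturally on the scale 1 / lam1.\<close>

definition "lam1 = sqrt (real d) * r1"
definition "lam2 = sqrt (real d) * r2"
definition "D = 1 + r1\<^sup>2 + r2\<^sup>2"
definition "q0 = 1 / D"
definition "q1 = r1\<^sup>2 / D"
definition "q2 = r2\<^sup>2 / D"
definition "p = (\<lambda>\<alpha>. tri \<alpha> * mon q0 q1 q2 \<alpha>)"
text \<open>Centring an exponent at its mean multiplies the function on the torus by a phase only,
  and brings its moments down to the scale \<open>lam1\<close>.\<close>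

definition "dev1 = (\<lambda>\<alpha>::expo. real (fst (snd \<alpha>)) - real d * q1)"
definition "dev2 = (\<lambda>\<alpha>::expo. real (snd (snd \<alpha>)) - real d * q2)"

lemma lam: "lam1 \<ge> 1" "lam2 \<ge> 1"
  using lam_ge_1 by (auto simp: lam1_def lam2_def)

lemma D: "1 \<le> D" "D \<le> 3"
  using r1 r2 power_le_one[of r1 2] power_le_one[of r2 2] by (auto simp: D_def)

lemma d_pos: "d > 0"
  using lam_ge_1 by (cases "d = 0") auto

lemma q_pos: "q0 > 0" "q1 > 0" "q2 > 0"
  using D r1 r2 by (auto simp: q0_def q1_def q2_def)

lemma q_sum: "q0 + q1 + q2 = 1"
  using D(1) by (simp add: q0_def q1_def q2_def flip: add_divide_distrib) (simp add: D_def)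

lemma d_q1: "real d * q1 = lam1\<^sup>2 / D" and d_q2: "real d * q2 = lam2\<^sup>2 / D"
  by (simp_all add: q1_def q2_def lam1_def lam2_def power_mult_distrib)

lemma p_pos: "p \<alpha> > 0"
  using q_pos by (cases \<alpha>) (simp add: p_def mon_def tri_pos)

text \<open>By the trinomial theorem the sum is a d-th power. In the quadratic bound for exp, the
  linear terms cancel against the centring, and d q1 a^2 + d q2 b^2 \<le> 2 remains.\<close>

lemma sum_p_exp_le:
  assumes "\<bar>a\<bar> \<le> 1 / lam1" "\<bar>b\<bar> \<le> 1 / lam2"
  shows "(\<Sum>\<alpha>\<in>expos d. p \<alpha> * exp (a * dev1 \<alpha> + b * dev2 \<alpha>)) \<le> exp 2"
proof -
  have ab: "\<bar>a\<bar> \<le> 1" "\<bar>b\<bar> \<le> 1"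
    using assms lam by (auto intro: order_trans[of _ "1 / lam1"] order_trans[of _ "1 / lam2"])
  have small: "real d * q1 * a\<^sup>2 \<le> 1" "real d * q2 * b\<^sup>2 \<le> 1"
  proof -
    have "lam1\<^sup>2 * a\<^sup>2 \<le> 1" "lam2\<^sup>2 * b\<^sup>2 \<le> 1"
      using assms lam power_mono[of "\<bar>a\<bar>" "1 / lam1" 2] power_mono[of "\<bar>b\<bar>" "1 / lam2" 2]
      by (auto simp: field_simps)
    then show "real d * q1 * a\<^sup>2 \<le> 1" "real d * q2 * b\<^sup>2 \<le> 1"
      using D by (auto simp: d_q1 d_q2 field_simps)
  qed
  have "p \<alpha> * exp (a * dev1 \<alpha> + b * dev2 \<alpha>)
      = exp (- (real d * (a * q1 + b * q2))) * (tri \<alpha> * mon q0 (q1 * exp a) (q2 * exp b) \<alpha>)" for \<alpha>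
    by (cases \<alpha>) (simp add: p_def mon_def dev1_def dev2_def power_mult_distrib exp_of_nat_mult [symmetric]
        exp_add [symmetric] algebra_simps)
  then have "(\<Sum>\<alpha>\<in>expos d. p \<alpha> * exp (a * dev1 \<alpha> + b * dev2 \<alpha>))
      = exp (- (real d * (a * q1 + b * q2))) * (q0 + q1 * exp a + q2 * exp b) ^ d"
    using trinomial_theorem[of q0 "q1 * exp a" "q2 * exp b" d] by (simp flip: sum_distrib_left)
  also have "\<dots> \<le> exp (- (real d * (a * q1 + b * q2))) * exp (a * q1 + b * q2 + (q1 * a\<^sup>2 + q2 * b\<^sup>2)) ^ d"
  proof (intro mult_left_mono power_mono)
    have "q0 + q1 * exp a + q2 * exp b \<le> q0 + q1 * (1 + a + a\<^sup>2) + q2 * (1 + b + b\<^sup>2)"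
      using q_pos ab by (intro add_mono mult_left_mono exp_le_quadratic) auto
    also have "\<dots> = 1 + (a * q1 + b * q2 + (q1 * a\<^sup>2 + q2 * b\<^sup>2))"
      using q_sum by (simp add: algebra_simps)
    also have "\<dots> \<le> exp (a * q1 + b * q2 + (q1 * a\<^sup>2 + q2 * b\<^sup>2))"
      by (rule exp_ge_add_one_self)
    finally show "q0 + q1 * exp a + q2 * exp b \<le> exp (a * q1 + b * q2 + (q1 * a\<^sup>2 + q2 * b\<^sup>2))" .
  qed (use q_pos in auto)
  also have "\<dots> = exp (real d * q1 * a\<^sup>2 + real d * q2 * b\<^sup>2)"
    by (simp add: exp_of_nat_mult [symmetric] exp_add [symmetric] algebra_simps)
  also have "\<dots> \<le> exp 2"
    using small by simp
  finally show ?thesis .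
qed

text \<open>With u = dev1 / lam1 and v = dev2 / lam2, even powers are bounded by factorials times
  exp(|u| + |v|), and this by the sum of the four exponentials of \<plusminus>u \<plusminus> v, each
  of mean at most exp 2.\<close>

lemma sum_p_moment_le:
  "(\<Sum>\<alpha>\<in>expos d. p \<alpha> * (dev1 \<alpha> ^ m * dev2 \<alpha> ^ n)\<^sup>2)
     \<le> 4 * exp 2 * (lam1 ^ (2 * m) * lam2 ^ (2 * n) * fact (2 * m) * fact (2 * n))"
proof -
  let ?C = "lam1 ^ (2 * m) * lam2 ^ (2 * n) * fact (2 * m) * fact (2 * n)"
  let ?E = "\<lambda>a b \<alpha>. p \<alpha> * exp (a / lam1 * dev1 \<alpha> + b / lam2 * dev2 \<alpha>)"
  have "p \<alpha> * (dev1 \<alpha> ^ m * dev2 \<alpha> ^ n)\<^sup>2 \<le> ?C * (?E 1 1 \<alpha> + ?E 1 (-1) \<alpha> + (?E (-1) 1 \<alpha> + ?E (-1) (-1) \<alpha>))" for \<alpha>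
  proof -
    define u where "u = dev1 \<alpha> / lam1"
    define v where "v = dev2 \<alpha> / lam2"
    have e: "exp \<bar>t\<bar> \<le> exp t + exp (- t)" for t :: real
      by (cases "t \<ge> 0") auto
    have "(dev1 \<alpha> ^ m * dev2 \<alpha> ^ n)\<^sup>2 = lam1 ^ (2 * m) * lam2 ^ (2 * n) * (\<bar>u\<bar> ^ (2 * m) * \<bar>v\<bar> ^ (2 * n))"
      using lam by (simp add: u_def v_def power_divide power_even_abs) (simp add: power_mult power_mult_distrib mult.commute)
    also have "\<dots> \<le> lam1 ^ (2 * m) * lam2 ^ (2 * n) *
        ((fact (2 * m) * exp \<bar>u\<bar>) * (fact (2 * n) * exp \<bar>v\<bar>))"
      using lam by (intro mult_left_mono mult_mono power_le_fact_exp) auto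
    also have "\<dots> = ?C * (exp \<bar>u\<bar> * exp \<bar>v\<bar>)" by simp
    also have "\<dots> \<le> ?C * ((exp u + exp (- u)) * (exp v + exp (- v)))"
      using lam by (intro mult_left_mono mult_mono e) auto
    also have "(exp u + exp (- u)) * (exp v + exp (- v))
        = exp (u + v) + exp (u - v) + (exp (- u + v) + exp (- u - v))"
      by (simp add: exp_add exp_diff exp_minus field_simps)
    finally have "p \<alpha> * (dev1 \<alpha> ^ m * dev2 \<alpha> ^ n)\<^sup>2
        \<le> p \<alpha> * (?C * (exp (u + v) + exp (u - v) + (exp (- u + v) + exp (- u - v))))"
      using p_pos[of \<alpha>] by (intro mult_left_mono) auto
    then show ?thesis
      by (simp add: u_def v_def algebra_simps)
  qed
  then have "(\<Sum>\<alpha>\<in>expos d. p \<alpha> * (dev1 \<alpha> ^ m * dev2 \<alpha> ^ n)\<^sup>2)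
     \<le> (\<Sum>\<alpha>\<in>expos d. ?C * (?E 1 1 \<alpha> + ?E 1 (-1) \<alpha> + (?E (-1) 1 \<alpha> + ?E (-1) (-1) \<alpha>)))"
    by (intro sum_mono)
  also have "\<dots> = ?C * ((\<Sum>\<alpha>\<in>expos d. ?E 1 1 \<alpha>) + (\<Sum>\<alpha>\<in>expos d. ?E 1 (-1) \<alpha>)
      + ((\<Sum>\<alpha>\<in>expos d. ?E (-1) 1 \<alpha>) + (\<Sum>\<alpha>\<in>expos d. ?E (-1) (-1) \<alpha>)))"
    by (simp only: sum_distrib_left [symmetric] sum.distrib)
  also have "\<dots> \<le> ?C * ((exp 2 + exp 2) + (exp 2 + exp 2))"
    using lam by (intro mult_left_mono add_mono sum_p_exp_le) auto
  finally show ?thesis by (simp add: mult_ac)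
qed

end

section \<open>Boundedness of the random function on a patch\<close>

lemma (in prob_space) prob_double_union_le:
  assumes [measurable]: "\<And>m n. A m n \<in> events"
    and le: "\<And>m n :: nat. prob (A m n) \<le> K * (1 / 4) ^ m * (1 / 4) ^ n"
  shows "prob (\<Union>m. \<Union>n. A m n) \<le> 2 * K"
proof -
  have K: "K \<ge> 0"
    using order_trans[OF measure_nonneg le[of 0 0]] by simp
  have geo: "summable (\<lambda>n. a * (1 / 4 :: real) ^ n)" "(\<Sum>n. a * (1 / 4) ^ n) = a * (4 / 3)" for a
    by (auto intro!: summable_mult summable_geometric simp: suminf_mult suminf_geometric)
  have 1: "prob (\<Union>n. A m n) \<le> K * (4 / 3) * (1 / 4) ^ m" for m
  proof -
    have s: "summable (\<lambda>n. prob (A m n))"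
      by (rule summable_comparison_test'[OF geo(1)[of "K * (1 / 4) ^ m"], of 0]) (use le in auto)
    have "prob (\<Union>n. A m n) \<le> (\<Sum>n. prob (A m n))"
      by (rule finite_measure_subadditive_countably[OF _ s]) auto
    also have "\<dots> \<le> (\<Sum>n. K * (1 / 4) ^ m * (1 / 4) ^ n)"
      by (rule suminf_le[OF le s geo(1)])
    finally show ?thesis by (simp add: geo(2))
  qed
  have s: "summable (\<lambda>m. prob (\<Union>n. A m n))"
    by (rule summable_comparison_test'[OF geo(1)[of "K * (4 / 3)"], of 0]) (use 1 in auto)
  have "prob (\<Union>m. \<Union>n. A m n) \<le> (\<Sum>m. prob (\<Union>n. A m n))"
    by (rule finite_measure_subadditive_countably[OF _ s]) auto
  also have "\<dots> \<le> (\<Sum>m. K * (4 / 3) * (1 / 4) ^ m)"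
    by (rule suminf_le[OF 1 s geo(1)])
  \<comment> \<open>The double geometric series contributes (4/3)^2 = 16/9.\<close>
  also have "\<dots> \<le> 2 * K"
    using K by (simp only: geo(2))
  finally show ?thesis .
qed

lemma norm_cis_taylor: "norm (cis x - 1 - \<i> * of_real x) \<le> x\<^sup>2 / 2"
  using iexp_approx1[of x 1] by (simp add: cis_conv_exp algebra_simps power2_eq_square)

lemma cos_ge_quadratic: "cos x \<ge> 1 - x\<^sup>2 / 2" for x :: real
  using order_trans[OF abs_Re_le_cmod norm_cis_taylor, of x] by simp

context torus_fibre
begin

text \<open>The torus over \<open>(ln r1, ln r2)\<close> is parametrised by its arguments; up to a constant factor this
  is the polynomial with orthonormal coordinates \<open>c\<close>.\<close>

definition fibre :: "(expo \<Rightarrow> complex) \<Rightarrow> real \<Rightarrow> real \<Rightarrow> complex" where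
  "fibre c \<theta>1 \<theta>2 = (\<Sum>\<alpha>\<in>expos d. c \<alpha> * of_real (sqrt (p \<alpha>)) *
     cis (real (fst (snd \<alpha>)) * \<theta>1 + real (snd (snd \<alpha>)) * \<theta>2))"

text \<open>\<open>norm_sum_cis_le\<close> is applied in \<theta>1, with the powers of
  \<open>dev2\<close> carried along, and then in \<theta>2. Each use costs a factor 2, and the patch
  size is such that |\<theta>| 4 lam \<le> 1/2.\<close>

lemma fibre_bound_of_taylor_coeffs:
  assumes B: "\<And>m n. norm (\<Sum>\<alpha>\<in>expos d. c \<alpha> * (of_real (sqrt (p \<alpha>)) * cis (real (fst (snd \<alpha>)) * \<phi>)
      * of_real (dev1 \<alpha> ^ m * dev2 \<alpha> ^ n))) \<le> K * (4 * lam1) ^ m * fact m * ((4 * lam2) ^ n * fact n)"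
    and \<theta>: "\<bar>\<theta>1\<bar> * lam1 \<le> 1 / 8" "\<bar>\<theta>2\<bar> * lam2 \<le> 1 / 8"
  shows "norm (fibre c (\<phi> + \<theta>1) \<theta>2) \<le> 4 * K"
proof -
  let ?c = "\<lambda>\<alpha>. c \<alpha> * of_real (sqrt (p \<alpha>)) * cis (real (fst (snd \<alpha>)) * \<phi>)"
  have 1: "norm (\<Sum>\<alpha>\<in>expos d. ?c \<alpha> * of_real (dev2 \<alpha> ^ n) * cis (dev1 \<alpha> * \<theta>1))
      \<le> 2 * (K * (4 * lam2) ^ n * fact n)" for n
  proof (rule norm_sum_cis_le[where R = "4 * lam1"])
    fix m
    show "norm (\<Sum>\<alpha>\<in>expos d. ?c \<alpha> * of_real (dev2 \<alpha> ^ n) * of_real (dev1 \<alpha> ^ m))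
        \<le> K * (4 * lam2) ^ n * fact n * (4 * lam1) ^ m * fact m"
      using B[of m n] by (simp add: mult_ac)
  qed (use lam \<theta> in auto)
  have 2: "norm (\<Sum>\<alpha>\<in>expos d. ?c \<alpha> * cis (dev1 \<alpha> * \<theta>1) * cis (dev2 \<alpha> * \<theta>2)) \<le> 2 * (2 * K)"
  proof (rule norm_sum_cis_le[where R = "4 * lam2"])
    fix n
    show "norm (\<Sum>\<alpha>\<in>expos d. ?c \<alpha> * cis (dev1 \<alpha> * \<theta>1) * of_real (dev2 \<alpha> ^ n))
        \<le> 2 * K * (4 * lam2) ^ n * fact n"
      using 1[of n] by (simp add: mult_ac)
  qed (use lam \<theta> in auto)
  \<comment> \<open>The means of the exponents contribute a common factor of modulus 1.\<close>
  have "fibre c (\<phi> + \<theta>1) \<theta>2 = cis (real d * q1 * \<theta>1 + real d * q2 * \<theta>2) *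
      (\<Sum>\<alpha>\<in>expos d. ?c \<alpha> * cis (dev1 \<alpha> * \<theta>1) * cis (dev2 \<alpha> * \<theta>2))"
    unfolding fibre_def sum_distrib_left
  proof (rule sum.cong[OF refl])
    fix \<alpha> :: expo
    have "cis (real (fst (snd \<alpha>)) * (\<phi> + \<theta>1) + real (snd (snd \<alpha>)) * \<theta>2)
        = cis (real d * q1 * \<theta>1 + real d * q2 * \<theta>2) * (cis (real (fst (snd \<alpha>)) * \<phi>)
          * cis (dev1 \<alpha> * \<theta>1) * cis (dev2 \<alpha> * \<theta>2))"
      by (simp add: cis_mult dev1_def dev2_def algebra_simps)
    then show "c \<alpha> * of_real (sqrt (p \<alpha>)) * cis (real (fst (snd \<alpha>)) * (\<phi> + \<theta>1) + real (snd (snd \<alpha>)) * \<theta>2)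
        = cis (real d * q1 * \<theta>1 + real d * q2 * \<theta>2) * (?c \<alpha> * cis (dev1 \<alpha> * \<theta>1) * cis (dev2 \<alpha> * \<theta>2))"
      by (simp add: mult_ac)
  qed
  then show ?thesis
    using 2 by (simp add: norm_mult)
qed

text \<open>A single event serves all angles of the patch, because it controls all Taylor
  coefficients at once. This avoids a supremum over uncountably many points.\<close>

lemma fibre_bound_event:
  assumes T: "T > 0"
  obtains G where "G \<in> sets (cgauss (expos d))" "measure (cgauss (expos d)) G \<ge> 1 - 16 * exp 3 / T"
    "\<And>c \<theta>1 \<theta>2. c \<in> G \<Longrightarrow> \<bar>\<theta>1\<bar> * lam1 \<le> 1 / 8 \<Longrightarrow> \<bar>\<theta>2\<bar> * lam2 \<le> 1 / 8
        \<Longrightarrow> norm (fibre c (\<phi> + \<theta>1) \<theta>2) \<le> 4 * sqrt T"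
proof -
  let ?I = "expos d"
  interpret prob_space "cgauss ?I" by (rule prob_space_cgauss) simp
  let ?C = "\<lambda>m n. lam1 ^ (2 * m) * lam2 ^ (2 * n) * fact (2 * m) * fact (2 * n)"
  let ?a = "\<lambda>m n \<alpha>. of_real (sqrt (p \<alpha>)) * cis (real (fst (snd \<alpha>)) * \<phi>) * of_real (dev1 \<alpha> ^ m * dev2 \<alpha> ^ n)"
  \<comment> \<open>The factor 4^(m + n) in the threshold makes the probabilities summable. Together
    with the 4^(m + n) from \<open>fact_double_le\<close> it produces the radii 4 lam1 and 4
    lam2.\<close>
  define A where "A = (\<lambda>m n. {c \<in> space (cgauss ?I).
      (norm (\<Sum>\<alpha>\<in>?I. ?a m n \<alpha> * c \<alpha>))\<^sup>2 \<ge> T * 4 ^ m * 4 ^ n * ?C m n})"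
  have A [measurable]: "A m n \<in> events" for m n
    unfolding A_def by measurable
  have C: "?C m n > 0" for m n
    using lam by simp
  have "prob (A m n) \<le> 8 * exp 3 / T * (1 / 4) ^ m * (1 / 4) ^ n" for m n
  proof -
    have "(\<Sum>\<alpha>\<in>?I. (norm (?a m n \<alpha>))\<^sup>2) = (\<Sum>\<alpha>\<in>?I. p \<alpha> * (dev1 \<alpha> ^ m * dev2 \<alpha> ^ n)\<^sup>2)"
    proof (rule sum.cong[OF refl])
      fix \<alpha>
      have "norm (?a m n \<alpha>) = sqrt (p \<alpha>) * \<bar>dev1 \<alpha> ^ m * dev2 \<alpha> ^ n\<bar>"
        using p_pos[of \<alpha>] by (simp only: norm_mult norm_cis norm_of_real) (simp add: less_imp_le)
      then show "(norm (?a m n \<alpha>))\<^sup>2 = p \<alpha> * (dev1 \<alpha> ^ m * dev2 \<alpha> ^ n)\<^sup>2"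
        using p_pos[of \<alpha>] by (simp only: power_mult_distrib power2_abs) simp
    qed
    also have "\<dots> \<le> 4 * exp 2 * ?C m n"
      by (rule sum_p_moment_le)
    finally have "prob (A m n) \<le> 2 * exp 1 * (4 * exp 2 * ?C m n) / (T * 4 ^ m * 4 ^ n * ?C m n)"
      unfolding A_def using C[of m n] T by (intro prob_cgauss_linear_ge) auto
    also have "\<dots> = 8 * (exp 1 * exp 2) / (T * 4 ^ m * 4 ^ n)"
      using C[of m n] T lam by (simp add: field_simps)
    also have "exp 1 * exp 2 = (exp 3 :: real)"
      by (simp flip: exp_add)
    finally show ?thesis
      by (simp add: power_divide)
  qed
  then have "prob (\<Union>m. \<Union>n. A m n) \<le> 2 * (8 * exp 3 / T)"
    by (intro prob_double_union_le A)
  then have "prob (space (cgauss ?I) - (\<Union>m. \<Union>n. A m n)) \<ge> 1 - 16 * exp 3 / T"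
    by (subst prob_compl) auto
  moreover have "space (cgauss ?I) - (\<Union>m. \<Union>n. A m n) \<in> events"
    by measurable
  moreover have "norm (fibre c (\<phi> + \<theta>1) \<theta>2) \<le> 4 * sqrt T"
    if c: "c \<in> space (cgauss ?I) - (\<Union>m. \<Union>n. A m n)" and \<theta>: "\<bar>\<theta>1\<bar> * lam1 \<le> 1 / 8" "\<bar>\<theta>2\<bar> * lam2 \<le> 1 / 8"
    for c \<theta>1 \<theta>2
  proof (rule fibre_bound_of_taylor_coeffs[OF _ \<theta>])
    fix m n
    let ?B = "\<Sum>\<alpha>\<in>?I. c \<alpha> * ?a m n \<alpha>"
    have "(norm ?B)\<^sup>2 < T * 4 ^ m * 4 ^ n * ?C m n"
      using c by (auto simp: A_def not_le mult.commute)
    also have "\<dots> \<le> T * 4 ^ m * 4 ^ n * (lam1 ^ (2 * m) * lam2 ^ (2 * n) * (2 ^ m * fact m)\<^sup>2 * (2 ^ n * fact n)\<^sup>2)"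
      using T lam by (intro mult_left_mono mult_mono fact_double_le) auto
    also have "\<dots> = (sqrt T * (4 * lam1) ^ m * fact m * ((4 * lam2) ^ n * fact n))\<^sup>2"
    proof -
      have "(4::real) ^ k = (2 ^ k)\<^sup>2" for k
        by (simp add: power2_eq_square flip: power_mult_distrib)
      then show ?thesis
        using T by (simp add: power_mult_distrib power_mult power_even_eq mult_ac)
    qed
    finally have *: "(norm ?B)\<^sup>2 < (sqrt T * (4 * lam1) ^ m * fact m * ((4 * lam2) ^ n * fact n))\<^sup>2" .
    have "0 \<le> sqrt T * (4 * lam1) ^ m * fact m * ((4 * lam2) ^ n * fact n)"
      using T lam by (intro mult_nonneg_nonneg zero_le_power) auto
    with * show "norm ?B \<le> sqrt T * (4 * lam1) ^ m * fact m * ((4 * lam2) ^ n * fact n)"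
      by (rule less_imp_le[OF power2_less_imp_less])
  qed
  ultimately show ?thesis using that by blast
qed

end

subsection \<open>Zeros forced by a peak section\<close>

context torus_fibre
begin

text \<open>The linear form with coefficients \<open>l0, l1, l2\<close> is chosen so that \<open>fibre\<close> of a peak section
  factors as in \<open>fibre_peak\<close>.\<close>

definition "l0 = - (of_real lam1 + \<i> * of_real lam2) / complex_of_real (real d * q0)"
definition "l1 = of_real lam1 / complex_of_real (real d * q1)"
definition "l2 = \<i> * of_real lam2 / complex_of_real (real d * q2)"

text \<open>Without the factor \<open>lin\<close>, and for s = 1, these would be the coordinates of
  the reproducing kernel at the point (\<phi>, 0) of the torus; with it, \<open>fibre\<close> of the
  section vanishes at that point. The amplitude \<open>s\<close> is fixed later.\<close>

definition peak :: "real \<Rightarrow> real \<Rightarrow> expo \<Rightarrow> complex" where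
  "peak s \<phi> \<alpha> = of_real s * of_real (sqrt (p \<alpha>)) * lin l0 l1 l2 \<alpha> * cis (- (real (fst (snd \<alpha>)) * \<phi>))"

lemma q_l: "of_real q0 * l0 = - (of_real lam1 + \<i> * of_real lam2) / of_nat d"
    "of_real q1 * l1 = of_real lam1 / of_nat d" "of_real q2 * l2 = \<i> * of_real lam2 / of_nat d"
  using q_pos d_pos by (simp_all add: l0_def l1_def l2_def field_simps)

lemma of_real_p: "complex_of_real (p \<alpha>) = of_real (tri \<alpha>) * mon (of_real q0) (of_real q1) (of_real q2) \<alpha>"
  by (cases \<alpha>) (simp add: p_def mon_def)

lemma mon_cis: "mon (of_real q0) (of_real q1 * cis \<theta>1) (of_real q2 * cis \<theta>2) \<alpha>
    = mon (of_real q0) (of_real q1) (of_real q2) \<alpha> * cis (real (fst (snd \<alpha>)) * \<theta>1 + real (snd (snd \<alpha>)) * \<theta>2)"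
  by (cases \<alpha>) (simp add: mon_def power_mult_distrib Complex.DeMoivre cis_mult [symmetric])

lemma fibre_add: "fibre (\<lambda>\<alpha>\<in>expos d. u \<alpha> + c \<alpha>) \<theta>1 \<theta>2 = fibre u \<theta>1 \<theta>2 + fibre c \<theta>1 \<theta>2"
  by (simp add: fibre_def distrib_right sum.distrib)

text \<open>The phases at \<phi> cancel and the two roots of \<open>p\<close> multiply to
  \<open>p\<close>, so \<open>trinomial_lin\<close> with weights q1 cis \<theta>1 and q2 cis
  \<theta>2 sums the series. The choice of \<open>l0\<close> makes the linear factor vanish at
  \<theta>1 = \<theta>2 = 0.\<close>

lemma fibre_peak:
  "fibre (peak s \<phi>) (\<phi> + \<theta>1) \<theta>2
    = of_real s * (of_real q0 + of_real q1 * cis \<theta>1 + of_real q2 * cis \<theta>2) ^ (d - 1)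
      * (of_real lam1 * (cis \<theta>1 - 1) + \<i> * of_real lam2 * (cis \<theta>2 - 1))"
proof -
  have "fibre (peak s \<phi>) (\<phi> + \<theta>1) \<theta>2 = of_real s * (\<Sum>\<alpha>\<in>expos d. of_real (tri \<alpha>) *
      mon (of_real q0) (of_real q1 * cis \<theta>1) (of_real q2 * cis \<theta>2) \<alpha> * lin l0 l1 l2 \<alpha>)"
    unfolding fibre_def sum_distrib_left
  proof (rule sum.cong[OF refl])
    fix \<alpha> :: expo
    have "complex_of_real (sqrt (p \<alpha>)) * of_real (sqrt (p \<alpha>)) = of_real (p \<alpha>)"
      using p_pos[of \<alpha>] by (simp flip: of_real_mult)
    moreover have "cis (- (real (fst (snd \<alpha>)) * \<phi>)) * cis (real (fst (snd \<alpha>)) * (\<phi> + \<theta>1) + real (snd (snd \<alpha>)) * \<theta>2)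
        = cis (real (fst (snd \<alpha>)) * \<theta>1 + real (snd (snd \<alpha>)) * \<theta>2)"
      by (simp add: cis_mult algebra_simps)
    moreover have "peak s \<phi> \<alpha> * of_real (sqrt (p \<alpha>)) * cis (real (fst (snd \<alpha>)) * (\<phi> + \<theta>1) + real (snd (snd \<alpha>)) * \<theta>2)
        = of_real s * ((of_real (sqrt (p \<alpha>)) * of_real (sqrt (p \<alpha>)))
          * (cis (- (real (fst (snd \<alpha>)) * \<phi>)) * cis (real (fst (snd \<alpha>)) * (\<phi> + \<theta>1) + real (snd (snd \<alpha>)) * \<theta>2))
          * lin l0 l1 l2 \<alpha>)"
      by (simp add: peak_def mult_ac)
    ultimately show "peak s \<phi> \<alpha> * of_real (sqrt (p \<alpha>)) * cis (real (fst (snd \<alpha>)) * (\<phi> + \<theta>1) + real (snd (snd \<alpha>)) * \<theta>2)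
      = of_real s * (of_real (tri \<alpha>) * mon (of_real q0) (of_real q1 * cis \<theta>1) (of_real q2 * cis \<theta>2) \<alpha> * lin l0 l1 l2 \<alpha>)"
      unfolding mon_cis by (simp only: of_real_p mult_ac)
  qed
  also have "\<dots> = of_real s * (of_real q0 + of_real q1 * cis \<theta>1 + of_real q2 * cis \<theta>2) ^ (d - 1)
      * (of_nat d * (of_real q0 * l0 + (of_real q1 * l1) * cis \<theta>1 + (of_real q2 * l2) * cis \<theta>2))"
    unfolding trinomial_lin by (simp add: mult_ac)
  also have "of_nat d * (of_real q0 * l0 + (of_real q1 * l1) * cis \<theta>1 + (of_real q2 * l2) * cis \<theta>2)
      = of_real lam1 * (cis \<theta>1 - 1) + \<i> * of_real lam2 * (cis \<theta>2 - 1)"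
    unfolding q_l using d_pos by (simp add: field_simps)
  finally show ?thesis .
qed

text \<open>On the patch the real part of the base is at least 1 - 1 / (64 d), and Bernoulli's
  inequality controls its power.\<close>

lemma norm_char_power_ge:
  assumes \<theta>: "\<bar>\<theta>1\<bar> * lam1 \<le> 1 / 8" "\<bar>\<theta>2\<bar> * lam2 \<le> 1 / 8"
  shows "norm (of_real q0 + of_real q1 * cis \<theta>1 + of_real q2 * cis \<theta>2) ^ (d - 1) \<ge> 1 / 2"
proof -
  let ?G = "of_real q0 + of_real q1 * cis \<theta>1 + of_real q2 * cis \<theta>2"
  have "real d * q1 * \<theta>1\<^sup>2 \<le> 1 / 64" "real d * q2 * \<theta>2\<^sup>2 \<le> 1 / 64"
  proof -
    have "lam1\<^sup>2 * \<theta>1\<^sup>2 \<le> (1 / 8)\<^sup>2" "lam2\<^sup>2 * \<theta>2\<^sup>2 \<le> (1 / 8)\<^sup>2"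
      using lam power_mono[OF \<theta>(1), of 2] power_mono[OF \<theta>(2), of 2] by (simp_all add: power_mult_distrib mult.commute)
    then have "lam1\<^sup>2 * \<theta>1\<^sup>2 / D \<le> 1 / 64 / 1" "lam2\<^sup>2 * \<theta>2\<^sup>2 / D \<le> 1 / 64 / 1"
      using D by (auto intro!: frac_le simp: power2_eq_square)
    then show "real d * q1 * \<theta>1\<^sup>2 \<le> 1 / 64" "real d * q2 * \<theta>2\<^sup>2 \<le> 1 / 64"
      by (simp_all add: d_q1 d_q2)
  qed
  then have small: "q1 * \<theta>1\<^sup>2 \<le> 1 / (64 * real d)" "q2 * \<theta>2\<^sup>2 \<le> 1 / (64 * real d)"
    using d_pos by (simp_all add: field_simps)
  have "1 - 1 / (64 * real d) \<le> 1 - q1 * \<theta>1\<^sup>2 / 2 - q2 * \<theta>2\<^sup>2 / 2"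
    using small by linarith
  also have "\<dots> = q0 + q1 * (1 - \<theta>1\<^sup>2 / 2) + q2 * (1 - \<theta>2\<^sup>2 / 2)"
    using q_sum by (simp add: algebra_simps)
  also have "\<dots> \<le> q0 + q1 * cos \<theta>1 + q2 * cos \<theta>2"
    using q_pos by (intro add_mono mult_left_mono cos_ge_quadratic) auto
  also have "\<dots> = Re ?G"
    by simp
  also have "\<dots> \<le> norm ?G"
    by (rule complex_Re_le_cmod)
  finally have G: "1 + - (1 / (64 * real d)) \<le> norm ?G" by simp
  have nn: "0 \<le> 1 + - (1 / (64 * real d))"
    using d_pos by (simp add: field_simps)
  have "1 / 2 \<le> 1 + real (d - 1) * - (1 / (64 * real d))"
    using d_pos by (simp add: field_simps)
  also have "\<dots> \<le> (1 + - (1 / (64 * real d))) ^ (d - 1)"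
    by (rule Bernoulli_inequality) (use nn in linarith)
  also have "\<dots> \<le> norm ?G ^ (d - 1)"
    by (rule power_mono[OF G nn])
  finally show ?thesis .
qed

lemma continuous_on_fibre [continuous_intros]:
  "continuous_on S g \<Longrightarrow> continuous_on S h \<Longrightarrow> continuous_on S (\<lambda>x. fibre c (g x) (h x))"
  unfolding fibre_def cis_conv_exp by (intro continuous_intros)

text \<open>In the coordinate w = lam1 \<theta>1 + \<i> lam2 \<theta>2, division by s G leaves F = L
  + perturbation on the disc of radius 1/8. There L is within 1/64 of \<i> w and the perturbation is
  at most 1/16, so w + \<i> F(w) has modulus at most 5/64 < 1/8.\<close>

lemma fibre_zero_of_peak:
  assumes s: "s > 0"
    and c: "\<And>\<theta>1 \<theta>2. \<bar>\<theta>1\<bar> * lam1 \<le> 1 / 8 \<Longrightarrow> \<bar>\<theta>2\<bar> * lam2 \<le> 1 / 8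
      \<Longrightarrow> norm (fibre c (\<phi> + \<theta>1) \<theta>2) \<le> s / 32"
  shows "\<exists>\<theta>1 \<theta>2. fibre (\<lambda>\<alpha>\<in>expos d. peak s \<phi> \<alpha> + c \<alpha>) \<theta>1 \<theta>2 = 0"
proof -
  define t1 where "t1 = (\<lambda>w::complex. Re w / lam1)"
  define t2 where "t2 = (\<lambda>w::complex. Im w / lam2)"
  define G where "G = (\<lambda>w. (of_real q0 + of_real q1 * cis (t1 w) + of_real q2 * cis (t2 w)) ^ (d - 1))"
  define L where "L = (\<lambda>w. of_real lam1 * (cis (t1 w) - 1) + \<i> * of_real lam2 * (cis (t2 w) - 1))"
  define F where "F = (\<lambda>w. L w + fibre c (\<phi> + t1 w) (t2 w) / (of_real s * G w))"
  have t: "\<bar>t1 w\<bar> * lam1 = \<bar>Re w\<bar>" "\<bar>t2 w\<bar> * lam2 = \<bar>Im w\<bar>" for w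
    using lam by (auto simp: t1_def t2_def)
  have small: "\<bar>t1 w\<bar> * lam1 \<le> 1 / 8" "\<bar>t2 w\<bar> * lam2 \<le> 1 / 8" if "w \<in> cball 0 (1 / 8)" for w
    unfolding t using that abs_Re_le_cmod[of w] abs_Im_le_cmod[of w] by auto
  have G: "norm (G w) \<ge> 1 / 2" if "w \<in> cball 0 (1 / 8)" for w
    unfolding G_def norm_power by (rule norm_char_power_ge[OF small[OF that]])
  have L: "norm (L w - \<i> * w) \<le> 1 / 64" if w: "w \<in> cball 0 (1 / 8)" for w
  proof -
    have "\<i> * w = \<i> * (of_real lam1 * of_real (t1 w)) - of_real lam2 * of_real (t2 w)"
      using lam by (simp add: t1_def t2_def complex_eq_iff)
    then have "L w - \<i> * w = of_real lam1 * (cis (t1 w) - 1 - \<i> * of_real (t1 w))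
        + \<i> * of_real lam2 * (cis (t2 w) - 1 - \<i> * of_real (t2 w))"
      by (simp add: L_def algebra_simps)
    also have "norm \<dots> \<le> lam1 * ((t1 w)\<^sup>2 / 2) + lam2 * ((t2 w)\<^sup>2 / 2)"
      using lam by (intro order_trans[OF norm_triangle_ineq] add_mono)
        (use norm_cis_taylor[of "t1 w"] norm_cis_taylor[of "t2 w"] in \<open>auto simp: norm_mult\<close>)
    also have "\<dots> \<le> 1 / 128 + 1 / 128"
    proof (intro add_mono)
      have "lam * (t\<^sup>2 / 2) \<le> 1 / 128" if "\<bar>t\<bar> * lam \<le> 1 / 8" "lam \<ge> 1" for t lam :: real
      proof -
        have "lam * t\<^sup>2 \<le> lam\<^sup>2 * t\<^sup>2"
          using that by (intro mult_right_mono) (auto simp: power2_eq_square)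
        also have "\<dots> = (\<bar>t\<bar> * lam)\<^sup>2" by (simp add: power_mult_distrib mult.commute)
        also have "\<dots> \<le> (1 / 8)\<^sup>2" using that by (intro power_mono) auto
        finally show ?thesis by (simp add: power2_eq_square)
      qed
      from this[OF small(1)[OF w] lam(1)] this[OF small(2)[OF w] lam(2)]
      show "lam1 * ((t1 w)\<^sup>2 / 2) \<le> 1 / 128" "lam2 * ((t2 w)\<^sup>2 / 2) \<le> 1 / 128" .
    qed
    finally show ?thesis by simp
  qed
  \<comment> \<open>The fixed points of this map are exactly the zeros of \<open>F\<close>.\<close>
  have "continuous_on (cball 0 (1 / 8)) (\<lambda>w. w + \<i> * F w)"
  proof -
    have "of_real s * G w \<noteq> 0" if "w \<in> cball 0 (1 / 8)" for w
      using G[OF that] s by auto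
    moreover have "continuous_on S t1" "continuous_on S t2" for S
      unfolding t1_def t2_def by (intro continuous_intros; use lam in auto)+
    ultimately show ?thesis
      unfolding F_def L_def by (intro continuous_intros) (auto simp: G_def cis_conv_exp intro!: continuous_intros)
  qed
  moreover have "(\<lambda>w. w + \<i> * F w) \<in> cball 0 (1 / 8) \<rightarrow> cball 0 (1 / 8)"
  proof
    fix w :: complex assume w: "w \<in> cball 0 (1 / 8)"
    have "norm (fibre c (\<phi> + t1 w) (t2 w) / (of_real s * G w)) \<le> (s / 32) / (s * (1 / 2))"
      unfolding norm_divide norm_mult using s G[OF w] by (intro frac_le c small[OF w] mult_mono) auto
    also have "\<dots> = 1 / 16" using s by simp
    finally have R: "norm (fibre c (\<phi> + t1 w) (t2 w) / (of_real s * G w)) \<le> 1 / 16" .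
    have "w + \<i> * F w = \<i> * ((L w - \<i> * w) + fibre c (\<phi> + t1 w) (t2 w) / (of_real s * G w))"
      by (simp add: F_def algebra_simps)
    also have "norm \<dots> \<le> 1 / 64 + 1 / 16"
      unfolding norm_mult using norm_triangle_mono[OF L[OF w] R] by simp
    finally show "w + \<i> * F w \<in> cball 0 (1 / 8)" by simp
  qed
  ultimately obtain w where w: "w \<in> cball 0 (1 / 8)" "w + \<i> * F w = w"
    using brouwer_ball[of "1 / 8" 0 "\<lambda>w. w + \<i> * F w"] by auto
  have G0: "G w \<noteq> 0"
    using G[OF w(1)] by auto
  have "fibre (\<lambda>\<alpha>\<in>expos d. peak s \<phi> \<alpha> + c \<alpha>) (\<phi> + t1 w) (t2 w)
      = of_real s * G w * L w + fibre c (\<phi> + t1 w) (t2 w)"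
    by (simp add: fibre_add fibre_peak G_def L_def)
  also have "\<dots> = of_real s * G w * F w"
    using G0 s by (simp add: F_def distrib_left)
  also have "\<dots> = 0" using w(2) by simp
  finally show ?thesis by blast
qed

end

subsection \<open>Almost orthogonality of peak sections\<close>

context torus_fibre
begin

text \<open>The characteristic function of the indicator of outcome 1 in one of the d independent
  trials. Its powers govern the correlation of peaks whose angles differ by
  \<open>t\<close>.\<close>

definition step_char :: "real \<Rightarrow> complex" where
  "step_char t = of_real q0 + of_real q1 * cis t + of_real q2"

text \<open>\<open>trinomial_lin_lin\<close> for \<open>lin\<close> and its conjugate, with q1
  multiplied by cis (\<psi> - \<phi>). In both linear factors the \<open>lam2\<close> terms cancel,
  because the peaks differ only in the first angle.\<close>

lemma inner_peak:
  "(\<Sum>\<alpha>\<in>expos d. peak s \<phi> \<alpha> * cnj (peak s \<psi> \<alpha>))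
    = of_real (s\<^sup>2) * (of_nat (d - 1) * step_char (\<psi> - \<phi>) ^ (d - 2) * (of_real lam1 * (cis (\<psi> - \<phi>) - 1))\<^sup>2 / of_nat d
      + step_char (\<psi> - \<phi>) ^ (d - 1) * (of_real ((r1\<^sup>2 + r2\<^sup>2) * D) + of_real D * cis (\<psi> - \<phi>) + of_real D))"
proof -
  let ?z = "cis (\<psi> - \<phi>)"
  have cnj_lin: "cnj (lin l0 l1 l2 \<alpha>) = lin (cnj l0) (cnj l1) (cnj l2) \<alpha>" for \<alpha>
    by (cases \<alpha>) (simp add: lin_def)
  have "(\<Sum>\<alpha>\<in>expos d. peak s \<phi> \<alpha> * cnj (peak s \<psi> \<alpha>))
      = of_real (s\<^sup>2) * (\<Sum>\<alpha>\<in>expos d. of_real (tri \<alpha>) * mon (of_real q0) (of_real q1 * ?z) (of_real q2) \<alpha>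
          * (lin l0 l1 l2 \<alpha> * lin (cnj l0) (cnj l1) (cnj l2) \<alpha>))"
    unfolding sum_distrib_left
  proof (rule sum.cong[OF refl])
    fix \<alpha> :: expo
    have 1: "complex_of_real (sqrt (p \<alpha>)) * of_real (sqrt (p \<alpha>)) = of_real (p \<alpha>)"
      using p_pos[of \<alpha>] by (simp flip: of_real_mult)
    have 2: "cis (- (real (fst (snd \<alpha>)) * \<phi>)) * cis (real (fst (snd \<alpha>)) * \<psi>)
        = cis (real (fst (snd \<alpha>)) * (\<psi> - \<phi>))"
      by (simp add: cis_mult algebra_simps)
    have 3: "mon (of_real q0) (of_real q1 * ?z) (of_real q2) \<alpha>
        = mon (of_real q0) (of_real q1) (of_real q2) \<alpha> * cis (real (fst (snd \<alpha>)) * (\<psi> - \<phi>))"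
      using mon_cis[of "\<psi> - \<phi>" 0 \<alpha>] by simp
    have "peak s \<phi> \<alpha> * cnj (peak s \<psi> \<alpha>) = of_real (s\<^sup>2) * ((of_real (sqrt (p \<alpha>)) * of_real (sqrt (p \<alpha>)))
        * (cis (- (real (fst (snd \<alpha>)) * \<phi>)) * cis (real (fst (snd \<alpha>)) * \<psi>))
        * (lin l0 l1 l2 \<alpha> * lin (cnj l0) (cnj l1) (cnj l2) \<alpha>))"
      by (simp add: peak_def cnj_lin cis_cnj power2_eq_square mult_ac)
    then show "peak s \<phi> \<alpha> * cnj (peak s \<psi> \<alpha>) = of_real (s\<^sup>2) * (of_real (tri \<alpha>) *
        mon (of_real q0) (of_real q1 * ?z) (of_real q2) \<alpha> * (lin l0 l1 l2 \<alpha> * lin (cnj l0) (cnj l1) (cnj l2) \<alpha>))"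
      unfolding 1 2 3 of_real_p by (simp only: mult_ac)
  qed
  also have "(\<Sum>\<alpha>\<in>expos d. of_real (tri \<alpha>) * mon (of_real q0) (of_real q1 * ?z) (of_real q2) \<alpha>
          * (lin l0 l1 l2 \<alpha> * lin (cnj l0) (cnj l1) (cnj l2) \<alpha>))
      = of_nat d * of_nat (d - 1) * step_char (\<psi> - \<phi>) ^ (d - 2)
          * (of_real q0 * l0 + of_real q1 * l1 * ?z + of_real q2 * l2)
          * cnj (of_real q0 * l0 + of_real q1 * l1 * cnj ?z + of_real q2 * l2)
        + step_char (\<psi> - \<phi>) ^ (d - 1) * (of_nat d * (of_real q0 * l0) * cnj l0
          + (of_nat d * (of_real q1 * l1) * cnj l1) * ?z + of_nat d * (of_real q2 * l2) * cnj l2)"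
    unfolding trinomial_lin_lin by (simp add: step_char_def algebra_simps)
  also have "of_real q0 * l0 + of_real q1 * l1 * ?z + of_real q2 * l2 = of_real lam1 * (?z - 1) / of_nat d"
    unfolding q_l by (simp add: diff_divide_distrib add_divide_distrib algebra_simps)
  also have "cnj (of_real q0 * l0 + of_real q1 * l1 * cnj ?z + of_real q2 * l2) = of_real lam1 * (?z - 1) / of_nat d"
    unfolding q_l by (simp add: diff_divide_distrib add_divide_distrib algebra_simps)
  also have "of_nat d * (of_real q0 * l0) * cnj l0 = of_real ((r1\<^sup>2 + r2\<^sup>2) * D)"
  proof -
    have "of_nat d * (of_real q0 * l0) * cnj l0
        = - (of_real lam1 + \<i> * of_real lam2) * cnj (- (of_real lam1 + \<i> * of_real lam2)) / complex_of_real (real d * q0)"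
      unfolding q_l using d_pos by (simp add: l0_def)
    also have "- (of_real lam1 + \<i> * of_real lam2) * cnj (- (of_real lam1 + \<i> * of_real lam2))
        = complex_of_real (lam1\<^sup>2 + lam2\<^sup>2)"
      by (simp add: power2_eq_square algebra_simps)
    also have "complex_of_real (lam1\<^sup>2 + lam2\<^sup>2) / complex_of_real (real d * q0) = of_real ((lam1\<^sup>2 + lam2\<^sup>2) / (real d * q0))"
      by simp
    also have "(lam1\<^sup>2 + lam2\<^sup>2) / (real d * q0) = (r1\<^sup>2 + r2\<^sup>2) * D"
      using d_pos D by (simp add: lam1_def lam2_def q0_def power_mult_distrib field_simps)
    finally show ?thesis .
  qed
  also have "of_nat d * (of_real q1 * l1) * cnj l1 = of_real D"
  proof -
    have "of_nat d * (of_real q1 * l1) * cnj l1 = of_real (lam1\<^sup>2 / (real d * q1))"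
      unfolding q_l using d_pos by (simp add: l1_def power2_eq_square)
    then show ?thesis using lam D by (simp add: d_q1)
  qed
  also have "of_nat d * (of_real q2 * l2) * cnj l2 = of_real D"
  proof -
    have "of_nat d * (of_real q2 * l2) * cnj l2 = of_real (lam2\<^sup>2 / (real d * q2))"
      unfolding q_l using d_pos q_pos by (simp add: l2_def power2_eq_square field_simps)
    then show ?thesis using lam D by (simp add: d_q2)
  qed
  also have "of_nat d * of_nat (d - 1) * step_char (\<psi> - \<phi>) ^ (d - 2) * (of_real lam1 * (?z - 1) / of_nat d)
        * (of_real lam1 * (?z - 1) / of_nat d)
      = of_nat (d - 1) * step_char (\<psi> - \<phi>) ^ (d - 2) * (of_real lam1 * (?z - 1))\<^sup>2 / of_nat d"
    using d_pos by (simp add: power2_eq_square)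
  finally show ?thesis .
qed

lemma coeff_le: "(r1\<^sup>2 + r2\<^sup>2) * D + D + D \<le> 12"
proof -
  have "r1\<^sup>2 + r2\<^sup>2 \<le> 2"
    using r1 r2 power_le_one[of r1 2] power_le_one[of r2 2] by auto
  then have "(r1\<^sup>2 + r2\<^sup>2) * D \<le> 2 * 3"
    using D by (intro mult_mono) auto
  then show ?thesis using D by linarith
qed

text \<open>At equal angles cis 0 - 1 = 0 removes the first term of
  \<open>inner_peak\<close>.\<close>

lemma Re_inner_peak_diag_le: "Re (\<Sum>\<alpha>\<in>expos d. peak s \<phi> \<alpha> * cnj (peak s \<phi> \<alpha>)) \<le> 12 * s\<^sup>2"
proof -
  have "step_char 0 = 1"
  proof -
    have "step_char 0 = of_real (q0 + q1 + q2)"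
      by (simp add: step_char_def)
    then show ?thesis by (simp only: q_sum) simp
  qed
  then have "(\<Sum>\<alpha>\<in>expos d. peak s \<phi> \<alpha> * cnj (peak s \<phi> \<alpha>)) = of_real (s\<^sup>2 * ((r1\<^sup>2 + r2\<^sup>2) * D + D + D))"
    using inner_peak[of s \<phi> \<phi>] by simp
  then show ?thesis
    using mult_left_mono[OF coeff_le, of "s\<^sup>2"] by (simp add: mult.commute)
qed

text \<open>The squared modulus is 1 - 2 q1 (1 - q1) (1 - cos t), and r1 \<le> 1 forces q1 \<le>
  1/2.\<close>

lemma norm_step_char_le: "norm (step_char t) \<le> exp (- (q1 * (1 - cos t) / 2))"
proof (rule power2_le_imp_le)
  have q: "q0 + q2 = 1 - q1" "q1 \<le> 1 / 2"
  proof -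
    have "r1\<^sup>2 \<le> 1" using r1 by (simp add: power_le_one)
    then have "2 * r1\<^sup>2 \<le> D" by (simp add: D_def add_increasing2)
    then show "q1 \<le> 1 / 2" using D by (simp add: q1_def divide_le_eq)
  qed (use q_sum in simp)
  have k: "step_char t = of_real (1 - q1) + of_real q1 * cis t"
    by (simp add: step_char_def flip: q(1))
  have "(norm (step_char t))\<^sup>2 = (1 - q1)\<^sup>2 + 2 * (1 - q1) * q1 * cos t + ((q1 * cos t)\<^sup>2 + (q1 * sin t)\<^sup>2)"
    unfolding k by (simp only: cmod_power2) (simp add: power2_eq_square algebra_simps)
  also have "(q1 * cos t)\<^sup>2 + (q1 * sin t)\<^sup>2 = q1\<^sup>2"
    by (simp add: power_mult_distrib flip: distrib_left)
  also have "(1 - q1)\<^sup>2 + 2 * (1 - q1) * q1 * cos t + q1\<^sup>2 = 1 - (1 - q1) * (2 * (q1 * (1 - cos t)))"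
    by (simp add: power2_eq_square algebra_simps)
  also have "\<dots> \<le> 1 - (1 / 2) * (2 * (q1 * (1 - cos t)))"
    using q q_pos by (intro diff_left_mono mult_right_mono) auto
  also have "\<dots> \<le> exp (- (q1 * (1 - cos t)))"
    using exp_ge_add_one_self[of "- (q1 * (1 - cos t))"] by simp
  also have "\<dots> = (exp (- (q1 * (1 - cos t) / 2)))\<^sup>2"
    by (simp flip: exp_double)
  finally show "(norm (step_char t))\<^sup>2 \<le> (exp (- (q1 * (1 - cos t) / 2)))\<^sup>2" .
qed simp

text \<open>The power of \<open>step_char\<close> decays exponentially in d q1, which is comparable
  to lam1^2, while the other factors in \<open>inner_peak\<close> grow at most linearly in
  d.\<close>

lemma Re_inner_peak_off_diag_le:
  assumes \<kappa>: "1 - cos (\<psi> - \<phi>) \<ge> \<kappa>" "\<kappa> > 0" and d: "d \<ge> 4"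
  shows "Re (\<Sum>\<alpha>\<in>expos d. peak s \<phi> \<alpha> * cnj (peak s \<psi> \<alpha>)) \<le> s\<^sup>2 * ((4 * real d + 12) * exp (- (\<kappa> * lam1\<^sup>2 / 12)))"
proof -
  let ?z = "cis (\<psi> - \<phi>)" and ?g = "step_char (\<psi> - \<phi>)"
  have g1: "norm ?g \<le> 1"
  proof (rule order_trans[OF norm_step_char_le])
    show "exp (- (q1 * (1 - cos (\<psi> - \<phi>)) / 2)) \<le> 1"
      using q_pos by simp
  qed
  have g: "norm ?g ^ (d - 2) \<le> exp (- (\<kappa> * lam1\<^sup>2 / 12))"
  proof -
    have "norm ?g ^ (d - 2) \<le> exp (- (q1 * (1 - cos (\<psi> - \<phi>)) / 2)) ^ (d - 2)"
      by (rule power_mono[OF norm_step_char_le]) simp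
    also have "\<dots> = exp (- (real (d - 2) * (q1 * (1 - cos (\<psi> - \<phi>)) / 2)))"
      by (simp flip: exp_of_nat_mult)
    also have "\<dots> \<le> exp (- (\<kappa> * lam1\<^sup>2 / 12))"
    proof -
      have "\<kappa> * lam1\<^sup>2 / 12 \<le> \<kappa> * (lam1\<^sup>2 / D) / 4"
        using D \<kappa> lam by (simp add: field_simps)
      also have "\<dots> = real d / 2 * (q1 * \<kappa> / 2)"
        by (simp flip: d_q1)
      \<comment> \<open>Here d \<ge> 4 enters, as d - 2 \<ge> d / 2.\<close>
      also have "\<dots> \<le> real (d - 2) * (q1 * (1 - cos (\<psi> - \<phi>)) / 2)"
        using d \<kappa> q_pos by (intro mult_mono divide_right_mono mult_left_mono) auto
      finally show ?thesis by simp
    qed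
    finally show ?thesis .
  qed
  have z: "norm (?z - 1) \<le> 2"
    using norm_triangle_ineq4[of ?z 1] by simp
  have "norm (of_nat (d - 1) * ?g ^ (d - 2) * (of_real lam1 * (?z - 1))\<^sup>2 / of_nat d)
      = real (d - 1) * norm ?g ^ (d - 2) * (lam1 * norm (?z - 1))\<^sup>2 / real d"
    using lam by (simp add: norm_divide norm_mult norm_power)
  also have "\<dots> \<le> real d * norm ?g ^ (d - 2) * (lam1 * 2)\<^sup>2 / real d"
    using z lam by (intro divide_right_mono mult_mono power_mono) auto
  also have "\<dots> = norm ?g ^ (d - 2) * (4 * lam1\<^sup>2)"
    using d by (simp add: power_mult_distrib)
  also have "\<dots> \<le> norm ?g ^ (d - 2) * (4 * real d)"
  proof -
    have "r1\<^sup>2 \<le> 1" using r1 by (simp add: power_le_one)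
    then have "lam1\<^sup>2 \<le> real d" by (simp add: lam1_def power_mult_distrib mult_left_le)
    then show ?thesis by (intro mult_left_mono) auto
  qed
  finally have 1: "norm (of_nat (d - 1) * ?g ^ (d - 2) * (of_real lam1 * (?z - 1))\<^sup>2 / of_nat d)
      \<le> norm ?g ^ (d - 2) * (4 * real d)" .
  have "norm (of_real ((r1\<^sup>2 + r2\<^sup>2) * D) + of_real D * ?z + of_real D) \<le> norm (complex_of_real ((r1\<^sup>2 + r2\<^sup>2) * D))
      + norm (of_real D * ?z) + norm (complex_of_real D)"
    by (intro order_trans[OF norm_triangle_ineq] add_right_mono norm_triangle_ineq)
  also have "\<dots> = (r1\<^sup>2 + r2\<^sup>2) * D + D + D"
    using D by (simp only: norm_mult norm_of_real norm_cis) (simp add: abs_mult)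
  also have "\<dots> \<le> 12" by (rule coeff_le)
  finally have "norm (?g ^ (d - 1) * (of_real ((r1\<^sup>2 + r2\<^sup>2) * D) + of_real D * ?z + of_real D)) \<le> norm ?g ^ (d - 1) * 12"
    unfolding norm_mult norm_power by (intro mult_left_mono) auto
  also have "\<dots> \<le> norm ?g ^ (d - 2) * 12"
    using g1 by (intro mult_right_mono power_decreasing) auto
  finally have 2: "norm (?g ^ (d - 1) * (of_real ((r1\<^sup>2 + r2\<^sup>2) * D) + of_real D * ?z + of_real D)) \<le> norm ?g ^ (d - 2) * 12" .
  have "Re (\<Sum>\<alpha>\<in>expos d. peak s \<phi> \<alpha> * cnj (peak s \<psi> \<alpha>)) \<le> norm (\<Sum>\<alpha>\<in>expos d. peak s \<phi> \<alpha> * cnj (peak s \<psi> \<alpha>))"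
    by (rule complex_Re_le_cmod)
  also have "\<dots> \<le> s\<^sup>2 * (norm ?g ^ (d - 2) * (4 * real d) + norm ?g ^ (d - 2) * 12)"
    unfolding inner_peak norm_mult by (intro mult_mono norm_triangle_mono 1 2) (auto simp: norm_power)
  also have "\<dots> = s\<^sup>2 * ((4 * real d + 12) * norm ?g ^ (d - 2))"
    by (simp add: algebra_simps)
  also have "\<dots> \<le> s\<^sup>2 * ((4 * real d + 12) * exp (- (\<kappa> * lam1\<^sup>2 / 12)))"
    by (intro mult_left_mono g) auto
  finally show ?thesis .
qed

text \<open>Translating by any one peak creates a zero with probability at least 1 - 16 exp 3 / T;
  averaging over M almost orthogonal peaks removes the translation at cost \<epsilon>.
  \<open>Z\<close> is any measurable set containing all coordinates with a zero.\<close>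

lemma prob_fibre_zero_ge:
  assumes Z: "Z \<in> sets (cgauss (expos d))"
    and zero: "\<And>c \<theta>1 \<theta>2. c \<in> space (cgauss (expos d)) \<Longrightarrow> fibre c \<theta>1 \<theta>2 = 0 \<Longrightarrow> c \<in> Z"
    and T: "T > 0" and M: "M > 0" and \<epsilon>: "\<epsilon> > 0" and d: "d \<ge> 4" and \<kappa>: "\<kappa> > 0"
    and sep: "\<And>k l. k < M \<Longrightarrow> l < M \<Longrightarrow> k \<noteq> l \<Longrightarrow> 1 - cos (\<phi> l - \<phi> k) \<ge> \<kappa>"
    and M_large: "2 * exp (24 * 128\<^sup>2 * T) \<le> \<epsilon>\<^sup>2 * real M"
    and d_large: "exp (2 * 128\<^sup>2 * T * ((4 * real d + 12) * exp (- (\<kappa> * lam1\<^sup>2 / 12)))) - 1 \<le> \<epsilon>\<^sup>2 / 2"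
  shows "measure (cgauss (expos d)) Z \<ge> 1 - 16 * exp 3 / T - \<epsilon>"
proof (rule prob_cgauss_ge_average[where M = M])
  interpret prob_space "cgauss (expos d)" by (rule prob_space_cgauss) simp
  \<comment> \<open>Chosen so that s / 32, the perturbation allowed by
    \<open>fibre_zero_of_peak\<close>, is the bound 4 sqrt T of
    \<open>fibre_bound_event\<close>.\<close>
  define s where "s = 128 * sqrt T"
  have s: "s > 0" "s\<^sup>2 = 128\<^sup>2 * T" "s / 32 = 4 * sqrt T"
    using T by (auto simp: s_def power_mult_distrib)
  define ip where "ip = (\<lambda>k l. Re (\<Sum>\<alpha>\<in>expos d. peak s (\<phi> k) \<alpha> * cnj (peak s (\<phi> l) \<alpha>)))"
  \<comment> \<open>The M diagonal terms are bounded but not small, so a large M absorbs them into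
    half of (\<epsilon> M)^2. The off-diagonal terms use the other half.\<close>
  have "exp (2 * ip k l) - 1 \<le> (if l = k then exp (24 * 128\<^sup>2 * T) else 0) + \<epsilon>\<^sup>2 / 2" if "k < M" "l < M" for k l
  proof (cases "k = l")
    case True
    have "exp (2 * ip k k) \<le> exp (24 * 128\<^sup>2 * T)"
      using Re_inner_peak_diag_le[of s "\<phi> k"] s(2) by (simp add: ip_def del: Re_sum)
    moreover have "0 \<le> \<epsilon>\<^sup>2 / 2" by simp
    ultimately have "exp (2 * ip k k) - 1 \<le> exp (24 * 128\<^sup>2 * T) + \<epsilon>\<^sup>2 / 2" by linarith
    then show ?thesis using True by simp
  next
    case False
    have "exp (2 * ip k l) \<le> exp (2 * 128\<^sup>2 * T * ((4 * real d + 12) * exp (- (\<kappa> * lam1\<^sup>2 / 12))))"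
      using Re_inner_peak_off_diag_le[OF sep[OF that False] \<kappa> d, of s] s(2) by (simp add: ip_def del: Re_sum)
    then have "exp (2 * ip k l) - 1 \<le> \<epsilon>\<^sup>2 / 2"
      using d_large by linarith
    then show ?thesis using False by simp
  qed
  then have "(\<Sum>k<M. \<Sum>l<M. exp (2 * ip k l) - 1)
      \<le> (\<Sum>k<M. \<Sum>l<M. (if l = k then exp (24 * 128\<^sup>2 * T) else 0) + \<epsilon>\<^sup>2 / 2)"
    by (intro sum_mono) auto
  also have "\<dots> = real M * exp (24 * 128\<^sup>2 * T) + (real M)\<^sup>2 * \<epsilon>\<^sup>2 / 2"
    by (simp add: sum.distrib power2_eq_square) (simp add: distrib_left)
  also have "\<dots> \<le> real M * (\<epsilon>\<^sup>2 * real M / 2) + (real M)\<^sup>2 * \<epsilon>\<^sup>2 / 2"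
    using M_large by (intro add_right_mono mult_left_mono) auto
  also have "\<dots> = (\<epsilon> * real M)\<^sup>2"
    by (simp add: power2_eq_square)
  finally show "(\<Sum>k<M. \<Sum>l<M. exp (2 * Re (\<Sum>\<alpha>\<in>expos d. peak s (\<phi> k) \<alpha> * cnj (peak s (\<phi> l) \<alpha>))) - 1)
      \<le> (\<epsilon> * real M)\<^sup>2"
    by (simp only: ip_def)
  fix k
  obtain G where G: "G \<in> events" "prob G \<ge> 1 - 16 * exp 3 / T"
    "\<And>c \<theta>1 \<theta>2. c \<in> G \<Longrightarrow> \<bar>\<theta>1\<bar> * lam1 \<le> 1 / 8 \<Longrightarrow> \<bar>\<theta>2\<bar> * lam2 \<le> 1 / 8
        \<Longrightarrow> norm (fibre c (\<phi> k + \<theta>1) \<theta>2) \<le> 4 * sqrt T"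
    using fibre_bound_event[OF T, of "\<phi> k"] by blast
  note G(2)
  also have "prob G \<le> prob {c \<in> space (cgauss (expos d)). (\<lambda>\<alpha>\<in>expos d. peak s (\<phi> k) \<alpha> + c \<alpha>) \<in> Z}"
  proof (rule finite_measure_mono)
    show "G \<subseteq> {c \<in> space (cgauss (expos d)). (\<lambda>\<alpha>\<in>expos d. peak s (\<phi> k) \<alpha> + c \<alpha>) \<in> Z}"
    proof
      fix c assume c: "c \<in> G"
      have "\<exists>\<theta>1 \<theta>2. fibre (\<lambda>\<alpha>\<in>expos d. peak s (\<phi> k) \<alpha> + c \<alpha>) \<theta>1 \<theta>2 = 0"
        using s(1) by (rule fibre_zero_of_peak) (use G(3)[OF c] s(3) in simp)
      then have "(\<lambda>\<alpha>\<in>expos d. peak s (\<phi> k) \<alpha> + c \<alpha>) \<in> Z"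
        using zero by auto
      then show "c \<in> {c \<in> space (cgauss (expos d)). (\<lambda>\<alpha>\<in>expos d. peak s (\<phi> k) \<alpha> + c \<alpha>) \<in> Z}"
        using sets.sets_into_space[OF G(1)] c by blast
    qed
    have "(\<lambda>c. \<lambda>\<alpha>\<in>expos d. peak s (\<phi> k) \<alpha> + c \<alpha>) \<in> measurable (cgauss (expos d)) (cgauss (expos d))"
      by (simp add: measurable_cong_sets[OF sets_cgauss sets_cgauss])
    from measurable_sets[OF this Z]
    show "{c \<in> space (cgauss (expos d)). (\<lambda>\<alpha>\<in>expos d. peak s (\<phi> k) \<alpha> + c \<alpha>) \<in> Z} \<in> events"
      by (simp add: vimage_def Int_def conj_commute)
  qed
  finally show "1 - 16 * exp 3 / T \<le> prob {c \<in> space (cgauss (expos d)). (\<lambda>\<alpha>\<in>expos d. peak s (\<phi> k) \<alpha> + c \<alpha>) \<in> Z}" .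
qed (use Z M \<epsilon> in auto)

end

subsection \<open>The probability of the amoeba event\<close>

text \<open>Reduces an uncountable union to countable operations: a continuous function on a compact
  set has a zero iff its modulus is arbitrarily small on a countable dense subset.\<close>

lemma sets_ex_zero_compact:
  fixes F :: "'a \<Rightarrow> 'b::{metric_space, second_countable_topology} \<Rightarrow> complex"
  assumes K: "compact K" and cont: "\<And>x. x \<in> space M \<Longrightarrow> continuous_on K (F x)"
    and meas [measurable]: "\<And>z. z \<in> K \<Longrightarrow> (\<lambda>x. F x z) \<in> borel_measurable M"
  shows "{x \<in> space M. \<exists>z\<in>K. F x z = 0} \<in> sets M"
proof -
  obtain S where S: "countable S" "S \<subseteq> K" "K \<subseteq> closure S"
    by (rule separable)
  have "(\<exists>z\<in>K. F x z = 0) \<longleftrightarrow> (\<forall>n. \<exists>z\<in>S. norm (F x z) < 1 / real (Suc n))" if x: "x \<in> space M" for x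
  proof
    assume "\<exists>z\<in>K. F x z = 0"
    then obtain z where z: "z \<in> K" "F x z = 0" by blast
    show "\<forall>n. \<exists>z\<in>S. norm (F x z) < 1 / real (Suc n)"
    proof
      fix n
      obtain \<delta> where \<delta>: "\<delta> > 0" "\<And>y. y \<in> K \<Longrightarrow> dist y z < \<delta> \<Longrightarrow> dist (F x y) (F x z) < 1 / real (Suc n)"
        using cont[OF x] z(1) unfolding continuous_on_iff by (metis of_nat_0_less_iff zero_less_Suc zero_less_divide_1_iff)
      obtain y where "y \<in> S" "dist y z < \<delta>"
        using S(3) z(1) \<delta>(1) by (meson closure_approachable subsetD)
      then show "\<exists>y\<in>S. norm (F x y) < 1 / real (Suc n)"
        using \<delta>(2)[of y] S(2) z(2) by auto
    qed
  next
    assume ap: "\<forall>n. \<exists>z\<in>S. norm (F x z) < 1 / real (Suc n)"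
    then have "K \<noteq> {}" using S(2) by blast
    moreover have "continuous_on K (\<lambda>z. norm (F x z))"
      by (intro continuous_intros cont x)
    ultimately obtain z where z: "z \<in> K" "\<And>y. y \<in> K \<Longrightarrow> norm (F x z) \<le> norm (F x y)"
      using continuous_attains_inf[OF K] by metis
    have "norm (F x z) < 1 / real (Suc n)" for n
      using ap z(2) S(2) by (meson le_less_trans subsetD)
    then have "norm (F x z) \<le> 0"
      by (metis inverse_eq_divide not_le reals_Archimedean less_asym)
    then show "\<exists>z\<in>K. F x z = 0" using z(1) by auto
  qed
  then have "{x \<in> space M. \<exists>z\<in>K. F x z = 0} = {x \<in> space M. \<forall>n. \<exists>z\<in>S. norm (F x z) < 1 / real (Suc n)}"
    by auto
  also have "\<dots> \<in> sets M"
  proof (intro sets.sets_Collect_countable_All sets.sets_Collect_countable_Ex' S(1))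
    fix n z assume "z \<in> S"
    then have [measurable]: "(\<lambda>x. F x z) \<in> borel_measurable M"
      using S(2) by (intro meas) auto
    show "{x \<in> space M. norm (F x z) < 1 / real (Suc n)} \<in> sets M" by measurable
  qed
  finally show ?thesis .
qed

text \<open>By homogeneity, vanishing at the representative (1, z1, z2) means vanishing on its whole
  orbit.\<close>

lemma mem_amoeba_eval:
  "(t1, t2) \<in> amoeba d P \<longleftrightarrow> (\<exists>z\<in>sphere 0 (exp t1) \<times> sphere 0 (exp t2). hpoly_eval d P (1, fst z, snd z) = 0)"
proof
  assume "(t1, t2) \<in> amoeba d P"
  then obtain z1 z2 where z: "z1 \<noteq> 0" "z2 \<noteq> 0" "t1 = ln (norm z1)" "t2 = ln (norm z2)"
    "affine_chart (z1, z2) \<in> vanishing_locus d P"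
    by (auto simp: amoeba_def torus_def Log_def)
  have "(1, z1, z2) \<in> affine_chart (z1, z2)"
    by (auto simp: affine_chart_def proj_pt_def intro!: exI[of _ 1])
  then have "hpoly_eval d P (1, z1, z2) = 0"
    using z(5) by (auto simp: vanishing_locus_def)
  then show "\<exists>z\<in>sphere 0 (exp t1) \<times> sphere 0 (exp t2). hpoly_eval d P (1, fst z, snd z) = 0"
    using z by (intro bexI[of _ "(z1, z2)"]) auto
next
  assume "\<exists>z\<in>sphere 0 (exp t1) \<times> sphere 0 (exp t2). hpoly_eval d P (1, fst z, snd z) = 0"
  then obtain z1 z2 where z: "norm z1 = exp t1" "norm z2 = exp t2" "hpoly_eval d P (1, z1, z2) = 0"
    by auto
  have "hpoly_eval d P v = 0" if "v \<in> affine_chart (z1, z2)" for v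
  proof -
    from that obtain c where "v = (c * 1, c * z1, c * z2)"
      by (auto simp: affine_chart_def proj_pt_def)
    then show ?thesis using z(3) by (simp only: hpoly_eval_scale) simp
  qed
  moreover have "affine_chart (z1, z2) \<in> CP2"
    by (auto simp: affine_chart_def CP2_def zero_prod_def)
  moreover have "z1 \<noteq> 0" "z2 \<noteq> 0" using z by auto
  ultimately have "(z1, z2) \<in> {z \<in> torus. affine_chart z \<in> vanishing_locus d P}"
    by (auto simp: torus_def vanishing_locus_def)
  moreover have "Log (z1, z2) = (t1, t2)" using z by (simp add: Log_def)
  ultimately show "(t1, t2) \<in> amoeba d P"
    unfolding amoeba_def by (metis image_eqI)
qed

lemma sets_amoeba_event: "{P \<in> hpolys d. (t1, t2) \<in> amoeba d P} \<in> sets (\<Pi>\<^sub>M \<alpha>\<in>expos d. borel)"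
proof -
  have "{P \<in> space (\<Pi>\<^sub>M \<alpha>\<in>expos d. borel). \<exists>z\<in>sphere 0 (exp t1) \<times> sphere 0 (exp t2).
      hpoly_eval d P (1, fst z, snd z) = 0} \<in> sets (\<Pi>\<^sub>M \<alpha>\<in>expos d. borel)"
  proof (rule sets_ex_zero_compact)
    show "compact (sphere (0::complex) (exp t1) \<times> sphere (0::complex) (exp t2))"
      by (intro compact_Times compact_sphere)
    show "continuous_on (sphere 0 (exp t1) \<times> sphere 0 (exp t2)) (\<lambda>z. hpoly_eval d P (1, fst z, snd z))" for P
      unfolding hpoly_eval_def case_prod_beta by (intro continuous_intros)
    show "(\<lambda>P. hpoly_eval d P (1, fst z, snd z)) \<in> borel_measurable (\<Pi>\<^sub>M \<alpha>\<in>expos d. borel)" for z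
      unfolding hpoly_eval_def case_prod_beta by measurable
  qed
  then show ?thesis
    by (simp add: mem_amoeba_eval hpolys_def space_PiM)
qed

section \<open>From orthonormal coordinates to random polynomials\<close>

definition normalise :: "nat \<Rightarrow> (expo \<Rightarrow> complex) \<Rightarrow> expo \<Rightarrow> complex" where
  "normalise d = (\<lambda>c. \<lambda>\<alpha>\<in>expos d. c \<alpha> / complex_of_real (sqrt (monom_norm_sq d \<alpha>)))"

lemma monom_norm_sq_pos: "monom_norm_sq d \<alpha> > 0"
  by (cases \<alpha>) (simp add: monom_norm_sq_def)

lemma hnorm_normalise: "(hnorm d (normalise d c))\<^sup>2 = (\<Sum>\<alpha>\<in>expos d. (norm (c \<alpha>))\<^sup>2)"
proof -
  have "Re (herm d (normalise d c) (normalise d c)) = (\<Sum>\<alpha>\<in>expos d. (norm (c \<alpha>))\<^sup>2)"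
    unfolding herm_def Re_sum
  proof (rule sum.cong[OF refl])
    fix \<alpha> assume \<alpha>: "\<alpha> \<in> expos d"
    have "complex_of_real (monom_norm_sq d \<alpha>) * normalise d c \<alpha> * cnj (normalise d c \<alpha>)
        = of_real (monom_norm_sq d \<alpha> * (norm (normalise d c \<alpha>))\<^sup>2)"
      by (simp only: mult.assoc complex_norm_square [symmetric] of_real_mult)
    then show "Re (complex_of_real (monom_norm_sq d \<alpha>) * normalise d c \<alpha> * cnj (normalise d c \<alpha>)) = (norm (c \<alpha>))\<^sup>2"
      using \<alpha> monom_norm_sq_pos[of d \<alpha>]
      by (simp only: Re_complex_of_real) (simp add: normalise_def norm_divide power_divide)
  qed
  then show ?thesis
    by (simp add: hnorm_def sum_nonneg)
qed

text \<open>\<open>normalise\<close> carries the Euclidean norm to \<open>hnorm\<close>, so the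
  density pulls back to that of \<open>cgauss\<close>; \<open>card_expos\<close> matches the powers
  of pi.\<close>

lemma hpoly_gauss_eq: "hpoly_gauss d = distr (cgauss (expos d)) (\<Pi>\<^sub>M \<alpha>\<in>expos d. borel) (normalise d)"
proof -
  have [measurable]: "cnj \<in> borel_measurable borel"
    by (intro borel_measurable_continuous_onI continuous_intros)
  have [measurable]: "(\<lambda>P. hnorm d P) \<in> borel_measurable (\<Pi>\<^sub>M \<alpha>\<in>expos d. borel)"
    unfolding hnorm_def herm_def by measurable
  have [measurable]: "normalise d \<in> measurable (\<Pi>\<^sub>M \<alpha>\<in>expos d. lborel) (\<Pi>\<^sub>M \<alpha>\<in>expos d. borel)"
    unfolding normalise_def by (rule measurable_normalise)
  have "hpoly_gauss d = density (distr (\<Pi>\<^sub>M \<alpha>\<in>expos d. lborel) (\<Pi>\<^sub>M \<alpha>\<in>expos d. borel) (normalise d))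
      (\<lambda>P. ennreal (exp (- (hnorm d P)\<^sup>2) / pi ^ dimN d))"
    by (simp add: hpoly_gauss_def hpoly_lebesgue_def normalise_def)
  also have "\<dots> = distr (cgauss (expos d)) (\<Pi>\<^sub>M \<alpha>\<in>expos d. borel) (normalise d)"
    unfolding cgauss_def by (subst density_distr) (auto simp: hnorm_normalise card_expos)
  finally show ?thesis .
qed

lemma amoeba_prob_eq:
  "amoeba_prob d (t1, t2) = measure (cgauss (expos d)) {c \<in> space (cgauss (expos d)). (t1, t2) \<in> amoeba d (normalise d c)}"
  and sets_amoeba_normalise: "{c \<in> space (cgauss (expos d)). (t1, t2) \<in> amoeba d (normalise d c)} \<in> sets (cgauss (expos d))"
proof -
  have m: "normalise d \<in> measurable (cgauss (expos d)) (\<Pi>\<^sub>M \<alpha>\<in>expos d. borel)"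
    unfolding normalise_def measurable_cong_sets[OF sets_cgauss refl] by (rule measurable_normalise)
  have eq: "normalise d -` {P \<in> hpolys d. (t1, t2) \<in> amoeba d P} \<inter> space (cgauss (expos d))
      = {c \<in> space (cgauss (expos d)). (t1, t2) \<in> amoeba d (normalise d c)}"
    by (auto simp: hpolys_def normalise_def)
  show "amoeba_prob d (t1, t2) = measure (cgauss (expos d)) {c \<in> space (cgauss (expos d)). (t1, t2) \<in> amoeba d (normalise d c)}"
    unfolding amoeba_prob_def hpoly_gauss_eq measure_distr[OF m sets_amoeba_event] eq ..
  show "{c \<in> space (cgauss (expos d)). (t1, t2) \<in> amoeba d (normalise d c)} \<in> sets (cgauss (expos d))"
    using measurable_sets[OF m sets_amoeba_event[of d t1 t2]] unfolding eq .
qed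

lemma (in torus_fibre) hpoly_eval_normalise:
  "hpoly_eval d (normalise d c) (1, of_real r1 * cis \<theta>1, of_real r2 * cis \<theta>2)
    = of_real (sqrt ((real d + 2) * (real d + 1) / 2 * D ^ d)) * fibre c \<theta>1 \<theta>2"
  unfolding hpoly_eval_def fibre_def sum_distrib_left case_prod_beta fst_conv snd_conv prod.collapse
proof (rule sum.cong[OF refl])
  fix \<alpha> assume \<alpha>: "\<alpha> \<in> expos d"
  obtain i0 i1 i2 where i: "\<alpha> = (i0, i1, i2)" "i0 + i1 + i2 = d"
    using \<alpha> by (auto simp: expos_def)
  let ?K = "(real d + 2) * (real d + 1) / 2 * D ^ d"
  \<comment> \<open>The squared modulus of a normalised monomial on the torus is its trinomial
    probability times a constant independent of \<alpha>.\<close>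
  have "(r1 ^ i1 * r2 ^ i2)\<^sup>2 / monom_norm_sq d \<alpha> = ?K * p \<alpha>"
  proof -
    have Dp: "D ^ d = D ^ i0 * D ^ i1 * D ^ i2"
      by (simp add: i(2) [symmetric] power_add)
    have "?K * p \<alpha> = (real d + 2) * (real d + 1) / 2 * tri \<alpha> * (D ^ d * mon q0 q1 q2 \<alpha>)"
      by (simp add: p_def)
    also have "D ^ d * mon q0 q1 q2 \<alpha> = (r1 ^ i1 * r2 ^ i2)\<^sup>2"
      using D unfolding Dp by (simp add: i mon_def q0_def q1_def q2_def power_divide power_mult_distrib)
        (simp add: power_mult [symmetric] mult.commute)
    also have "(real d + 2) * (real d + 1) / 2 * tri \<alpha> = 1 / monom_norm_sq d \<alpha>"
    proof -
      have f: "fact (d + 2) = (real d + 2) * (real d + 1) * fact d"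
        by (simp add: algebra_simps)
      show ?thesis
        unfolding i(1) tri_def monom_norm_sq_def case_prod_conv i(2) f by simp
    qed
    finally show ?thesis by simp
  qed
  then have "sqrt ((r1 ^ i1 * r2 ^ i2)\<^sup>2 / monom_norm_sq d \<alpha>) = sqrt (?K * p \<alpha>)" by simp
  then have eq: "r1 ^ i1 * r2 ^ i2 / sqrt (monom_norm_sq d \<alpha>) = sqrt ?K * sqrt (p \<alpha>)"
    using r1 r2 by (simp only: real_sqrt_divide real_sqrt_mult real_sqrt_abs) simp
  have "normalise d c \<alpha> * 1 ^ i0 * (of_real r1 * cis \<theta>1) ^ i1 * (of_real r2 * cis \<theta>2) ^ i2
      = c \<alpha> * of_real (r1 ^ i1 * r2 ^ i2 / sqrt (monom_norm_sq d \<alpha>)) * cis (real i1 * \<theta>1 + real i2 * \<theta>2)"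
    using \<alpha> by (simp add: normalise_def power_mult_distrib Complex.DeMoivre flip: cis_mult)
  also have "\<dots> = of_real (sqrt ?K) * (c \<alpha> * of_real (sqrt (p \<alpha>)) * cis (real i1 * \<theta>1 + real i2 * \<theta>2))"
    unfolding eq by simp
  finally show "normalise d c \<alpha> * 1 ^ fst \<alpha> * (of_real r1 * cis \<theta>1) ^ fst (snd \<alpha>) * (of_real r2 * cis \<theta>2) ^ snd (snd \<alpha>)
    = of_real (sqrt ?K) * (c \<alpha> * of_real (sqrt (p \<alpha>)) *
        cis (real (fst (snd \<alpha>)) * \<theta>1 + real (snd (snd \<alpha>)) * \<theta>2))"
    by (simp add: i)
qed

section \<open>Choice of the constants and the limit\<close>

lemma roots_of_unity_separated:
  "\<exists>\<kappa>>0. \<forall>k<M. \<forall>l<M. k \<noteq> l \<longrightarrow> \<kappa> \<le> 1 - cos (2 * pi * real l / real M - 2 * pi * real k / real M)"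
proof -
  define f where "f = (\<lambda>(k, l). 1 - cos (2 * pi * real l / real M - 2 * pi * real k / real M))"
  \<comment> \<open>There are finitely many pairs, so the minimum gap is positive and depends on
    \<open>M\<close> alone. The extra 1 keeps the set nonempty when M \<le> 1.\<close>
  define S where "S = insert 1 (f ` {(k, l). k < M \<and> l < M \<and> k \<noteq> l})"
  have "finite {(k, l). k < M \<and> l < M \<and> k \<noteq> l}"
    by (rule finite_subset[of _ "{..<M} \<times> {..<M}"]) auto
  then have fin: "finite S"
    by (simp add: S_def)
  have pos: "f (k, l) > 0" if kl: "k < M" "l < M" "k \<noteq> l" for k l
  proof -
    have "cos (2 * pi * real l / real M - 2 * pi * real k / real M) \<noteq> 1"
    proof
      assume "cos (2 * pi * real l / real M - 2 * pi * real k / real M) = 1"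
      then obtain n :: int where "2 * pi * real l / real M - 2 * pi * real k / real M = of_int n * 2 * pi"
        unfolding cos_one_2pi_int by blast
      then have "(2 * pi) * (real l - real k) = (2 * pi) * (of_int n * real M)"
        using kl by (simp add: field_simps)
      then have "real l - real k = of_int n * real M"
        by (subst (asm) mult_left_cancel) auto
      then have "of_int (int l - int k) = (of_int (n * int M) :: real)" by simp
      then have "int l - int k = n * int M" by (simp only: of_int_eq_iff)
      then have "int M dvd int l - int k" by simp
      then have "\<bar>int M\<bar> \<le> \<bar>int l - int k\<bar>"
        by (rule dvd_imp_le_int [rotated]) (use kl in auto)
      then show False using kl by linarith
    qed
    then show ?thesis
      unfolding f_def case_prod_conv
      using cos_le_one[of "2 * pi * real l / real M - 2 * pi * real k / real M"] by linarith
  qed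
  have "Min S > 0"
    using fin pos by (subst Min_gr_iff) (auto simp: S_def)
  moreover have "Min S \<le> f (k, l)" if "k < M" "l < M" "k \<noteq> l" for k l
    using fin that by (intro Min_le) (auto simp: S_def)
  ultimately show ?thesis by (auto simp: f_def)
qed

text \<open>The order of choices matters: T depends on \<epsilon>, M on T and \<epsilon>, \<kappa>
  on M, and only then is d taken large, uniformly in t1 and t2.\<close>

lemma eventually_amoeba_prob_ge:
  assumes \<epsilon>: "\<epsilon> > 0"
  shows "\<forall>\<^sub>F d in sequentially. \<forall>t1 t2. - (1/2) * ln (real d) + ln (ln (real d)) \<le> t1 \<and> t1 \<le> 0 \<and>
    - (1/2) * ln (real d) + ln (ln (real d)) \<le> t2 \<and> t2 \<le> 0 \<longrightarrow> amoeba_prob d (t1, t2) \<ge> 1 - 2 * \<epsilon>"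
proof -
  define T where "T = 16 * exp 3 / \<epsilon>"
  have T: "T > 0" "16 * exp 3 / T = \<epsilon>" using \<epsilon> by (auto simp: T_def)
  obtain M :: nat where M: "real M > 2 * exp (24 * 128\<^sup>2 * T) / \<epsilon>\<^sup>2"
    using reals_Archimedean2 by blast
  have M0: "M > 0"
    using M \<epsilon> by (metis divide_nonneg_nonneg exp_ge_zero gr0I less_le_not_le mult_nonneg_nonneg of_nat_0 zero_le_numeral zero_le_power2)
  have M_large: "2 * exp (24 * 128\<^sup>2 * T) \<le> \<epsilon>\<^sup>2 * real M"
    using M \<epsilon> by (simp add: field_simps)
  let ?\<phi> = "\<lambda>k. 2 * pi * real k / real M"
  obtain \<kappa> where \<kappa>: "\<kappa> > 0" "\<And>k l. k < M \<Longrightarrow> l < M \<Longrightarrow> k \<noteq> l \<Longrightarrow> \<kappa> \<le> 1 - cos (?\<phi> l - ?\<phi> k)"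
    using roots_of_unity_separated[of M] by blast
  \<comment> \<open>The term ln (ln d) in the lower bound on t1 gives lam1 \<ge> ln d, and
    exp(-\<kappa> (ln d)^2 / 12) beats the linear factor in d.\<close>
  have "(\<lambda>d. (4 * real d + 12) * exp (- (\<kappa> * (ln (real d))\<^sup>2 / 12))) \<longlonglongrightarrow> 0"
    using \<kappa>(1) by real_asymp
  then have "(\<lambda>d. exp (2 * 128\<^sup>2 * T * ((4 * real d + 12) * exp (- (\<kappa> * (ln (real d))\<^sup>2 / 12)))) - 1)
      \<longlonglongrightarrow> exp (2 * 128\<^sup>2 * T * 0) - 1"
    by (intro tendsto_intros)
  then have "\<forall>\<^sub>F d in sequentially.
      exp (2 * 128\<^sup>2 * T * ((4 * real d + 12) * exp (- (\<kappa> * (ln (real d))\<^sup>2 / 12)))) - 1 < \<epsilon>\<^sup>2 / 2"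
    by (rule order_tendstoD) (use \<epsilon> in simp)
  moreover have "\<forall>\<^sub>F d in sequentially. ln (real d) \<ge> 1"
    by real_asymp
  ultimately show ?thesis
    using eventually_ge_at_top[of 4]
  proof eventually_elim
    case (elim d)
    show ?case
    proof (intro allI impI)
      fix t1 t2
      assume t: "- (1/2) * ln (real d) + ln (ln (real d)) \<le> t1 \<and> t1 \<le> 0 \<and>
        - (1/2) * ln (real d) + ln (ln (real d)) \<le> t2 \<and> t2 \<le> 0"
      have d: "d > 0" using elim(3) by simp
      have ln_le: "ln (real d) \<le> sqrt (real d) * exp t" if "- (1/2) * ln (real d) + ln (ln (real d)) \<le> t" for t
      proof -
        have "ln (real d) = exp (ln (ln (real d)))" using elim(2) by simp
        also have "\<dots> \<le> exp (ln (real d) / 2 + t)" using that by simp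
        also have "\<dots> = sqrt (real d) * exp t"
          using d by (simp add: exp_add ln_sqrt [symmetric])
        finally show ?thesis .
      qed
      interpret torus_fibre d "exp t1" "exp t2"
        using t ln_le[of t1] ln_le[of t2] elim(2) by unfold_locales auto
      have lam: "ln (real d) \<le> lam1" using ln_le[of t1] t by (simp add: lam1_def)
      let ?Z = "{c \<in> space (cgauss (expos d)). (t1, t2) \<in> amoeba d (normalise d c)}"
      have "1 - 16 * exp 3 / T - \<epsilon> \<le> measure (cgauss (expos d)) ?Z"
      proof (rule prob_fibre_zero_ge[OF sets_amoeba_normalise _ T(1) M0 \<epsilon> elim(3) \<kappa>(1) \<kappa>(2) M_large])
        fix c \<theta>1 \<theta>2 assume c: "c \<in> space (cgauss (expos d))" "fibre c \<theta>1 \<theta>2 = 0"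
        have "hpoly_eval d (normalise d c) (1, of_real (exp t1) * cis \<theta>1, of_real (exp t2) * cis \<theta>2) = 0"
          using c(2) by (simp only: hpoly_eval_normalise) simp
        then have "(t1, t2) \<in> amoeba d (normalise d c)"
          unfolding mem_amoeba_eval
          by (intro bexI[of _ "(of_real (exp t1) * cis \<theta>1, of_real (exp t2) * cis \<theta>2)"]) (auto simp: norm_mult)
        then show "c \<in> ?Z" using c(1) by simp
      next
        have "(ln (real d))\<^sup>2 \<le> lam1\<^sup>2" using lam elim(2) by (intro power_mono) auto
        then have "exp (- (\<kappa> * lam1\<^sup>2 / 12)) \<le> exp (- (\<kappa> * (ln (real d))\<^sup>2 / 12))"
          using \<kappa>(1) by simp
        then have "exp (2 * 128\<^sup>2 * T * ((4 * real d + 12) * exp (- (\<kappa> * lam1\<^sup>2 / 12))))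
            \<le> exp (2 * 128\<^sup>2 * T * ((4 * real d + 12) * exp (- (\<kappa> * (ln (real d))\<^sup>2 / 12))))"
          using T(1) by (intro exp_le_cancel_iff[THEN iffD2] mult_left_mono) auto
        then show "exp (2 * 128\<^sup>2 * T * ((4 * real d + 12) * exp (- (\<kappa> * lam1\<^sup>2 / 12)))) - 1 \<le> \<epsilon>\<^sup>2 / 2"
          using elim(1) by linarith
      qed
      then show "1 - 2 * \<epsilon> \<le> amoeba_prob d (t1, t2)"
        using T(2) by (simp add: amoeba_prob_eq)
    qed
  qed
qed

theorem corollary5p9:
  "(\<lambda>d::nat. Inf {amoeba_prob d (t1, t2) | t1 t2 :: real.
        - (1/2) * ln (real d) + ln (ln (real d)) \<le> t1 \<and> t1 \<le> 0 \<and>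
        - (1/2) * ln (real d) + ln (ln (real d)) \<le> t2 \<and> t2 \<le> 0}) \<longlonglongrightarrow> 1"
proof (rule LIMSEQ_I)
  fix r :: real assume r: "r > 0"
  define A where "A = (\<lambda>d::nat. {amoeba_prob d (t1, t2) | t1 t2 :: real.
        - (1/2) * ln (real d) + ln (ln (real d)) \<le> t1 \<and> t1 \<le> 0 \<and>
        - (1/2) * ln (real d) + ln (ln (real d)) \<le> t2 \<and> t2 \<le> 0})"
  have "\<forall>\<^sub>F d in sequentially. - (1/2) * ln (real d) + ln (ln (real d)) \<le> 0"
    by real_asymp
  moreover have "r / 4 > 0" using r by simp
  note eventually_amoeba_prob_ge[OF this]
  ultimately have "\<forall>\<^sub>F d in sequentially. norm (Inf (A d) - 1) < r"
  proof eventually_elim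
    case (elim d)
    \<comment> \<open>Once ln (ln d) \<le> ln d / 2, the origin is an admissible point. The infimum
      is then over a nonempty set and at most 1.\<close>
    have ne: "amoeba_prob d (0, 0) \<in> A d"
      unfolding A_def using elim(1) by blast
    have "1 - r / 2 \<le> Inf (A d)"
      using ne by (intro cInf_greatest) (use elim(2) in \<open>auto simp: A_def\<close>)
    moreover have "Inf (A d) \<le> amoeba_prob d (0, 0)"
      by (rule cInf_lower[OF ne]) (auto simp: A_def bdd_below_def amoeba_prob_def intro!: exI[of _ 0])
    moreover have "amoeba_prob d (0, 0) \<le> 1"
      unfolding amoeba_prob_eq by (rule prob_space.prob_le_1[OF prob_space_cgauss]) simp
    ultimately show ?case using r by (simp add: abs_less_iff)
  qed
  then show "\<exists>no. \<forall>d\<ge>no. norm (Inf {amoeba_prob d (t1, t2) | t1 t2 :: real.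
        - (1/2) * ln (real d) + ln (ln (real d)) \<le> t1 \<and> t1 \<le> 0 \<and>
        - (1/2) * ln (real d) + ln (ln (real d)) \<le> t2 \<and> t2 \<le> 0} - 1) < r"
    unfolding A_def eventually_sequentially .
qed

end
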